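(* Let $m\in\mathbb{N}$, let $h:\mathbb{N}^m\to\mathbb{N}$ be a polynomial having no constant term, and let $A\subseteq\mathbb{N}$. The following statements are equivalent. (1) There exist functions $\alpha:\mathcal{P}_f(\mathbb{N}^{\mathbb{N}})\to\mathbb{N}$ and $H:\mathcal{P}_f(\mathbb{N}^{\mathbb{N}})\to\mathcal{P}_f(\mathbb{N})$ such that (a) if $F,G\in\mathcal{P}_f(\mathbb{N}^{\mathbb{N}})$ and $F\subsetneq G$, then $\max H(F)<\min H(G)$; and (b) whenever $(G_i)_{i\in\mathbb{N}}$ is a sequence in $\mathcal{P}_f(\mathbb{N}^{\mathbb{N}})$ with $G_1\subsetneq G_2\subsetneq\cdots\subsetneq G_n\subsetneq\cdots$, then for all $\beta_1<\cdots<\beta_m$ in $\mathcal{P}_f(\mathbb{N})$ and all choices of $f_i\in G_i$ ($i\in\mathbb{N}$), one has $$h\left(\sum_{i\in\beta_1}\Bigl(\alpha(G_i)+\sum_{t\in H(G_i)}f_i(t)\Bigr),\ldots,\sum_{i\in\beta_m}\Bigl(\alpha(G_i)+\sum_{t\in H(G_i)}f_i(t)\Bigr)\right)\in A.$$ (2) There exists an idempotent $p$ in $(\mathcal{J},+)$ such that $A\in\tilde h\left(\bigotimes_{i=1}^m p\right)$.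
   Context: $\mathbb{N}$ is the set of positive integers; $\mathcal{P}_f(X)$ is the set of nonempty finite subsets of $X$; $\mathbb{N}^{\mathbb{N}}$ is the set of all functions $\mathbb{N}\to\mathbb{N}$. For $\beta,\gamma\in\mathcal{P}_f(\mathbb{N})$, $\beta<\gamma$ means $\max\beta<\min\gamma$. $\beta X$ denotes the set of ultrafilters on a discrete set $X$ (Stone–Čech compactification). On $\beta\mathbb{N}$: $A\in p+q$ iff $\{x\in\mathbb{N}:-x+A\in q\}\in p$, where $-x+A=\{y\in\mathbb{N}:x+y\in A\}$. An ultrafilter $p$ is idempotent if $p+p=p$. For a map $h:\mathbb{N}^m\to\mathbb{N}$, $\tilde h:\beta(\mathbb{N}^m)\to\beta\mathbb{N}$ is its continuous extension: $A\in\tilde h(u)$ iff $h^{-1}(A)\in u$. A set $A\subseteq\mathbb{N}$ is a $J$-set if for every $F\in\mathcal{P}_f(\mathbb{N}^{\mathbb{N}})$ there exist $a\in\mathbb{N}$ and $\beta\in\mathcal{P}_f(\mathbb{N})$ such that $a+\sum_{t\in\beta}f(t)\in A$ for all $f\in F$. $\mathcal{J}=\{p\in\beta\mathbb{N}:\text{every }A\in p\text{ is a }J\text{-set}\}$; it is a two-sided ideal of $(\beta\mathbb{N},+)$. Tensor products: for ultrafilters $p_1,\ldots,p_k$ on $\mathbb{N}$, $\bigotimes_{i=1}^k p_i$ is the ultrafilter on $\mathbb{N}^k$ defined recursively by $\bigotimes_{i=1}^1p_i=p_1$, and, for $A\subseteq\mathbb{N}^{k+1}$, $A\in\bigotimes_{i=1}^{k+1}p_i$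 iff $\{(x_1,\ldots,x_k)\in\mathbb{N}^k:\{x_{k+1}\in\mathbb{N}:(x_1,\ldots,x_{k+1})\in A\}\in p_{k+1}\}\in\bigotimes_{i=1}^kp_i$. $\bigotimes_{i=1}^mp$ is the case $p_i=p$ for all $i$. *)

theory Defs
  imports Complex_Main "HOL-Library.FuncSet" "HOL-Library.Poly_Mapping"
begin

definition Npos :: "nat set" where
  "Npos = {n. 0 < n}"

definition Pf :: "'a set \<Rightarrow> 'a set set" where
  "Pf X = {F. F \<subseteq> X \<and> finite F \<and> F \<noteq> {}}"

text \<open>Functions on a set are represented extensionally, so that the elements of
  \<open>Npos_fun\<close> (and of \<open>tuples k\<close> below) are in bijection with actual functions on the set of positive
  integers (with \<open>k\<close>-tuples); in particular inclusions between sets of such functions are not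
  affected by values outside the domain.\<close>

definition Npos_fun :: "(nat \<Rightarrow> nat) set" where
  "Npos_fun = Npos \<rightarrow>\<^sub>E Npos"

definition tuples :: "nat \<Rightarrow> (nat \<Rightarrow> nat) set" where
  "tuples k = {1..k} \<rightarrow>\<^sub>E Npos"

definition block_less :: "nat set \<Rightarrow> nat set \<Rightarrow> bool" where
  "block_less B C \<longleftrightarrow> Max B < Min C"

definition ultrafilter_on :: "'a set \<Rightarrow> 'a set set \<Rightarrow> bool" where
  "ultrafilter_on X u \<longleftrightarrow>
     u \<subseteq> Pow X \<and> X \<in> u \<and> {} \<notin> u \<and>
     (\<forall>A\<in>u. \<forall>B\<in>u. A \<inter> B \<in> u) \<and>
     (\<forall>A\<in>u. \<forall>B. A \<subseteq> B \<and> B \<subseteq> X \<longrightarrow> B \<in> u) \<and>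
     (\<forall>A. A \<subseteq> X \<longrightarrow> A \<in> u \<or> X - A \<in> u)"

definition stone_cech :: "'a set \<Rightarrow> 'a set set set" where
  "stone_cech X = {u. ultrafilter_on X u}"

definition uf_plus :: "nat set set \<Rightarrow> nat set set \<Rightarrow> nat set set" where
  "uf_plus p q = {A. A \<subseteq> Npos \<and> {x \<in> Npos. {y \<in> Npos. x + y \<in> A} \<in> q} \<in> p}"

definition uf_idempotent :: "nat set set \<Rightarrow> bool" where
  "uf_idempotent p \<longleftrightarrow> uf_plus p p = p"

definition uf_extension :: "'a set \<Rightarrow> ('a \<Rightarrow> nat) \<Rightarrow> 'a set set \<Rightarrow> nat set set" where
  "uf_extension X h u = {A. A \<subseteq> Npos \<and> {x \<in> X. h x \<in> A} \<in> u}"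

definition J_set :: "nat set \<Rightarrow> bool" where
  "J_set A \<longleftrightarrow>
     (\<forall>F\<in>Pf Npos_fun. \<exists>a\<in>Npos. \<exists>B\<in>Pf Npos. \<forall>f\<in>F. a + (\<Sum>t\<in>B. f t) \<in> A)"

definition J_ultrafilters :: "nat set set set" where
  "J_ultrafilters = {p \<in> stone_cech Npos. \<forall>A\<in>p. J_set A}"

text \<open>The tensor product of \<open>p 1, \<dots>, p k\<close>, for \<open>k \<ge> 1\<close>.  The base case uses the identification of
  positive integers with 1-tuples.  The value for \<open>k = 0\<close>, the only ultrafilter on the one-point set
  of empty tuples, is a convention.\<close>

fun uf_tensor :: "(nat \<Rightarrow> nat set set) \<Rightarrow> nat \<Rightarrow> (nat \<Rightarrow> nat) set set" where
  "uf_tensor p 0 = {tuples 0}"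
| "uf_tensor p (Suc 0) =
     {A. A \<subseteq> tuples 1 \<and> {x \<in> Npos. (\<lambda>i\<in>{1..1}. x) \<in> A} \<in> p 1}"
| "uf_tensor p (Suc (Suc k)) =
     {A. A \<subseteq> tuples (Suc (Suc k)) \<and>
         {x \<in> tuples (Suc k). {y \<in> Npos. x(Suc (Suc k) := y) \<in> A} \<in> p (Suc (Suc k))}
           \<in> uf_tensor p (Suc k)}"

text \<open>Multivariate real polynomials are finitely supported maps from monomials to coefficients, a
  monomial being a finitely supported map from variable indices to exponents; the constant
  monomial is \<open>0\<close>.\<close>

type_synonym mpolynomial = "(nat \<Rightarrow>\<^sub>0 nat) \<Rightarrow>\<^sub>0 real"

definition mpoly_vars :: "mpolynomial \<Rightarrow> nat set" where
  "mpoly_vars P = (\<Union>M\<in>Poly_Mapping.keys P. Poly_Mapping.keys M)"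

definition mpoly_eval :: "mpolynomial \<Rightarrow> (nat \<Rightarrow> real) \<Rightarrow> real" where
  "mpoly_eval P x =
     (\<Sum>M\<in>Poly_Mapping.keys P. Poly_Mapping.lookup P M *
        (\<Prod>i\<in>Poly_Mapping.keys M. x i ^ Poly_Mapping.lookup M i))"

text \<open>Real coefficients cover every polynomial function taking positive integer values on tuples of
  positive integers: its coefficients are necessarily rational, but need not be positive or integral.\<close>

definition poly_map_no_const :: "nat \<Rightarrow> ((nat \<Rightarrow> nat) \<Rightarrow> nat) \<Rightarrow> bool" where
  "poly_map_no_const m h \<longleftrightarrow>
     h \<in> tuples m \<rightarrow> Npos \<and>
     (\<exists>P :: mpolynomial. mpoly_vars P \<subseteq> {1..m} \<and> Poly_Mapping.lookup P 0 = 0 \<and>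
        (\<forall>x\<in>tuples m. real (h x) = mpoly_eval P (\<lambda>i. real (x i))))"

end

theory Submission
  imports Defs "HOL-Library.Function_Algebras"
begin

text \<open>
  The constraint on block sums only concerns the set \<open>D\<close> of tuples that \<open>h\<close> sends into \<open>A\<close>.

  From an idempotent \<open>p\<close>, one chooses \<open>\<alpha> F\<close> and \<open>H F\<close> by recursion on the finite set \<open>F\<close>: only finitely
  many partial tuples of block sums arise along chains below \<open>F\<close>, each imposes on the next summand a
  condition that holds for \<open>p\<close>-most numbers (a star set \<open>{y \<in> C. - y + C \<in> p}\<close>), and the
  intersection of these conditions is a \<open>J\<close>-set.

  Conversely, the sums along chains above \<open>F\<close>, for \<open>F\<close> finite, form a base of a filter \<open>Q\<close> whose
  ultrafilters are a closed subsemigroup. A minimal idempotent \<open>p\<close> of it consists of \<open>J\<close>-sets: given a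
  finite set \<open>F\<close> of functions, the vectors, indexed by \<open>j \<in> F\<close>, of chain sums in which some summands
  use a common function and others use \<open>j\<close> form a subsemigroup containing the diagonal, those in which
  \<open>j\<close> occurs at all form an ideal, and minimality puts an ultrafilter of that ideal over \<open>p\<close> in every
  coordinate. Compactness arguments are carried out with filters instead of closed sets of
  ultrafilters, the order on filters corresponding to inclusion of closed sets.
\<close>

section \<open>Semigroups of filters\<close>

text \<open>Zorn's lemma for the reversed order. The closure of \<Phi> under infima of nonempty
  chains is where compactness enters: such an infimum is the intersection of a chain of closed sets
  of ultrafilters.\<close>

lemma minimal_filter_exists:
  fixes F\<^sub>0 :: "'a filter"
  assumes "\<Phi> F\<^sub>0"
    and chain: "\<And>C. C \<noteq> {} \<Longrightarrow> (\<And>F. F \<in> C \<Longrightarrow> \<Phi> F) \<Longrightarrow>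
                 (\<forall>F\<in>C. \<forall>G\<in>C. F \<le> G \<or> G \<le> F) \<Longrightarrow> \<Phi> (Inf C)"
  obtains M where "M \<le> F\<^sub>0" "\<Phi> M" "\<And>N. N \<le> M \<Longrightarrow> \<Phi> N \<Longrightarrow> N = M"
proof -
  let ?A = "{F. F \<le> F\<^sub>0 \<and> \<Phi> F}"
  have "\<exists>M\<in>?A. \<forall>N\<in>?A. N \<le> M \<longrightarrow> N = M"
  proof (rule predicate_Zorn)
    show "partial_order_on ?A (relation_of (\<lambda>F G. G \<le> F) ?A)"
      by (rule partial_order_on_relation_ofI) auto
    show "\<exists>U\<in>?A. \<forall>F\<in>C. U \<le> F" if "C \<in> Chains (relation_of (\<lambda>F G. G \<le> F) ?A)" for C
    proof (cases "C = {}")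
      case True
      then show ?thesis using assms(1) by auto
    next
      case False
      have lin: "\<forall>F\<in>C. \<forall>G\<in>C. F \<le> G \<or> G \<le> F"
        using that by (auto simp: Chains_def relation_of_def)
      have "C \<subseteq> ?A"
        using that by (auto simp: Chains_def relation_of_def)
      then have "Inf C \<in> ?A"
        using False lin chain[of C] by (auto intro: Inf_lower2)
      then show ?thesis by (auto intro: Inf_lower)
    qed
  qed
  then obtain M where M: "M \<le> F\<^sub>0" "\<Phi> M" "\<forall>N\<in>?A. N \<le> M \<longrightarrow> N = M" by blast
  show thesis
  proof (rule that[OF M(1,2)])
    fix N assume "N \<le> M" "\<Phi> N"
    moreover have "N \<le> F\<^sub>0" using \<open>N \<le> M\<close> M(1) by (rule order_trans)
    ultimately show "N = M" using M(3) by simp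
  qed
qed

text \<open>A chain is directed downwards, so its members form a base of the infimum. In particular,
  infima of chains of proper filters stay proper.\<close>

lemma eventually_Inf_chain:
  fixes C :: "'a filter set"
  assumes "C \<noteq> {}" "\<forall>F\<in>C. \<forall>G\<in>C. F \<le> G \<or> G \<le> F"
  shows "eventually P (Inf C) \<longleftrightarrow> (\<exists>F\<in>C. eventually P F)"
proof (rule eventually_Inf_base[OF assms(1)])
  show "\<exists>x\<in>C. x \<le> inf F G" if "F \<in> C" "G \<in> C" for F G
    using assms(2) that by (metis inf.absorb1 inf.absorb2 order_refl)
qed

lemma Inf_chain_neq_bot:
  fixes C :: "'a filter set"
  assumes "C \<noteq> {}" "\<forall>F\<in>C. \<forall>G\<in>C. F \<le> G \<or> G \<le> F" "\<And>F. F \<in> C \<Longrightarrow> F \<noteq> bot"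
  shows "Inf C \<noteq> bot"
  using eventually_Inf_chain[OF assms(1,2), of "\<lambda>_. False"] assms(3)
  by (auto simp: trivial_limit_def)

section \<open>Ultrafilters as minimal proper filters\<close>

definition ultra :: "'a filter \<Rightarrow> bool" where
  "ultra F \<longleftrightarrow> F \<noteq> bot \<and> (\<forall>P. eventually P F \<or> eventually (\<lambda>x. \<not> P x) F)"

lemma ultra_neq_bot: "ultra F \<Longrightarrow> F \<noteq> bot"
  by (simp add: ultra_def)

lemma ultra_not_eventually: "ultra F \<Longrightarrow> \<not> eventually P F \<longleftrightarrow> eventually (\<lambda>x. \<not> P x) F"
  using eventually_conj[of P F "\<lambda>x. \<not> P x"] by (auto simp: ultra_def trivial_limit_def)

lemma ultra_minimal:
  assumes "ultra U" "V \<le> U" "V \<noteq> bot"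
  shows "V = U"
proof (rule antisym[OF assms(2)], rule filter_leI)
  fix P assume P: "eventually P V"
  show "eventually P U"
  proof (rule ccontr)
    assume "\<not> eventually P U"
    then have "eventually (\<lambda>x. \<not> P x) V"
      using assms ultra_not_eventually filter_leD by blast
    with P have "eventually (\<lambda>x. False) V" by eventually_elim auto
    with assms(3) show False by (simp add: trivial_limit_def)
  qed
qed

text \<open>Meant for a filter \<open>M\<close> minimal with some property that one of its two
  restrictions, to \<open>P\<close> or to the complement, always inherits; minimality then makes
  this restriction equal to \<open>M\<close>.\<close>

lemma ultra_if_inf_principal:
  assumes "\<And>P. inf M (principal {x. P x}) = M \<or> inf M (principal {x. \<not> P x}) = M" "M \<noteq> bot"
  shows "ultra M"
  unfolding ultra_def
proof (intro conjI allI)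
  fix P
  have "eventually Q M" if "inf M (principal {x. Q x}) = M" for Q
    using eventually_inf_principal[of Q M "{x. Q x}"] by (simp add: that)
  then show "eventually P M \<or> eventually (\<lambda>x. \<not> P x) M"
    using assms(1)[of P] by blast
qed fact

lemma ultra_exists:
  assumes "F \<noteq> bot"
  obtains U where "U \<le> F" "ultra U"
proof -
  obtain M where M: "M \<le> F" "M \<noteq> bot" and min: "\<And>N. N \<le> M \<Longrightarrow> N \<noteq> bot \<Longrightarrow> N = M"
  proof (rule minimal_filter_exists[of "\<lambda>F. F \<noteq> bot" F])
    show "Inf C \<noteq> bot" if "C \<noteq> {}" "\<And>F. F \<in> C \<Longrightarrow> F \<noteq> bot"
      "\<forall>F\<in>C. \<forall>G\<in>C. F \<le> G \<or> G \<le> F" for C :: "'a filter set"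
      using that by (intro Inf_chain_neq_bot)
  qed (use assms in auto)
  have "ultra M"
  proof (rule ultra_if_inf_principal[OF _ M(2)])
    fix P
    have "inf M (principal {x. P x}) \<noteq> bot \<or> inf M (principal {x. \<not> P x}) \<noteq> bot"
    proof (rule ccontr)
      assume "\<not> ?thesis"
      then have "eventually (\<lambda>x. \<not> P x) M" "eventually (\<lambda>x. P x) M"
        by (auto simp: trivial_limit_def eventually_inf_principal)
      then have "eventually (\<lambda>x. False) M" by eventually_elim auto
      with M(2) show False by (simp add: trivial_limit_def)
    qed
    then show "inf M (principal {x. P x}) = M \<or> inf M (principal {x. \<not> P x}) = M"
      using min by (metis inf_le1)
  qed
  with M(1) show thesis by (rule that)
qed

section \<open>Addition of filters, extending the addition of ultrafilters\<close>

definition filter_plus :: "'a::semigroup_add filter \<Rightarrow> 'a filter \<Rightarrow> 'a filter" (infixl "\<oplus>" 65) where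
  "F \<oplus> G = Abs_filter (\<lambda>P. \<forall>\<^sub>F x in F. \<forall>\<^sub>F y in G. P (x + y))"

lemma eventually_filter_plus:
  "eventually P (F \<oplus> G) \<longleftrightarrow> (\<forall>\<^sub>F x in F. \<forall>\<^sub>F y in G. P (x + y))"
  unfolding filter_plus_def
proof (rule eventually_Abs_filter, rule is_filter.intro)
  show "\<forall>\<^sub>F x in F. \<forall>\<^sub>F y in G. P (x + y) \<and> Q (x + y)"
    if "\<forall>\<^sub>F x in F. \<forall>\<^sub>F y in G. P (x + y)" "\<forall>\<^sub>F x in F. \<forall>\<^sub>F y in G. Q (x + y)" for P Q
    using that by eventually_elim (rule eventually_conj)
  show "\<forall>\<^sub>F x in F. \<forall>\<^sub>F y in G. Q (x + y)"
    if "\<forall>x. P x \<longrightarrow> Q x" "\<forall>\<^sub>F x in F. \<forall>\<^sub>F y in G. P (x + y)" for P Q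
    using that(2)
  proof eventually_elim
    case (elim x)
    then show ?case by eventually_elim (use that(1) in blast)
  qed
qed auto

lemma filter_plus_assoc: "(F \<oplus> G) \<oplus> H = F \<oplus> (G \<oplus> H)"
  by (simp add: filter_eq_iff eventually_filter_plus add.assoc)

lemma filter_plus_mono:
  assumes "F \<le> F'" "G \<le> G'"
  shows "F \<oplus> G \<le> F' \<oplus> G'"
proof (rule filter_leI)
  fix P assume "eventually P (F' \<oplus> G')"
  then have "\<forall>\<^sub>F x in F. \<forall>\<^sub>F y in G'. P (x + y)"
    unfolding eventually_filter_plus using assms(1) filter_leD by blast
  then show "eventually P (F \<oplus> G)"
    unfolding eventually_filter_plus by eventually_elim (use assms(2) filter_leD in blast)
qed

lemma filter_plus_neq_bot: "F \<noteq> bot \<Longrightarrow> G \<noteq> bot \<Longrightarrow> F \<oplus> G \<noteq> bot"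
  by (simp add: trivial_limit_def eventually_filter_plus)

lemma bot_filter_plus: "bot \<oplus> G = bot"
  by (simp add: filter_eq_iff eventually_filter_plus)

lemma ultra_filter_plus:
  assumes "ultra F" "ultra G"
  shows "ultra (F \<oplus> G)"
  unfolding ultra_def
proof (intro conjI allI)
  show "F \<oplus> G \<noteq> bot" using assms by (simp add: filter_plus_neq_bot ultra_neq_bot)
  show "eventually P (F \<oplus> G) \<or> eventually (\<lambda>x. \<not> P x) (F \<oplus> G)" for P
    unfolding eventually_filter_plus
    by (simp flip: ultra_not_eventually[OF assms(1)] ultra_not_eventually[OF assms(2)])
qed

lemma filtermap_filter_plus:
  assumes "\<And>x y. f (x + y) = f x + f y"
  shows "filtermap f (F \<oplus> G) = filtermap f F \<oplus> filtermap f G"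
  by (simp add: filter_eq_iff eventually_filter_plus eventually_filtermap assms)

lemma ultra_filtermap: "ultra F \<Longrightarrow> ultra (filtermap f F)"
  by (auto simp: ultra_def filtermap_bot_iff eventually_filtermap)

text \<open>Adding \<open>q\<close> on the right is continuous, so the ultrafilters below
  \<open>F \<oplus> q\<close> are the images of those below \<open>F\<close>. A preimage of
  \<open>e\<close> is found as a minimal \<open>M \<le> F\<close> with
  \<open>e \<le> M \<oplus> q\<close>.\<close>

lemma ultra_le_filter_plusE:
  assumes "ultra e" "ultra q" "e \<le> F \<oplus> q"
  obtains i where "ultra i" "i \<le> F" "e = i \<oplus> q"
proof -
  obtain M where M: "M \<le> F" "e \<le> M \<oplus> q" and min: "\<And>N. N \<le> M \<Longrightarrow> e \<le> N \<oplus> q \<Longrightarrow> N = M"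
  proof (rule minimal_filter_exists[of "\<lambda>M. e \<le> M \<oplus> q" F])
    fix C :: "'a filter set"
    assume C: "C \<noteq> {}" "\<And>F. F \<in> C \<Longrightarrow> e \<le> F \<oplus> q" "\<forall>F\<in>C. \<forall>G\<in>C. F \<le> G \<or> G \<le> F"
    show "e \<le> Inf C \<oplus> q"
    proof (rule filter_leI)
      fix P assume "eventually P (Inf C \<oplus> q)"
      then obtain F where "F \<in> C" "eventually P (F \<oplus> q)"
        unfolding eventually_filter_plus eventually_Inf_chain[OF C(1,3)] by blast
      then show "eventually P e" using C(2) filter_leD by blast
    qed
  qed (use assms in auto)
  have "ultra M"
  proof (rule ultra_if_inf_principal)
    show "M \<noteq> bot"
      using M(2) ultra_neq_bot[OF assms(1)] by (auto simp: bot_filter_plus bot_unique)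
    fix P
    \<comment> \<open>If both halves of \<open>M\<close> failed, two sets outside \<open>e\<close>
      would have a union that belongs to \<open>M \<oplus> q\<close> and hence to \<open>e\<close>,
      which an ultrafilter excludes.\<close>
    have "e \<le> inf M (principal {x. P x}) \<oplus> q \<or> e \<le> inf M (principal {x. \<not> P x}) \<oplus> q"
    proof (rule ccontr)
      assume "\<not> ?thesis"
      then obtain A B where A: "\<forall>\<^sub>F x in M. P x \<longrightarrow> (\<forall>\<^sub>F y in q. A (x + y))" "\<not> eventually A e"
        and B: "\<forall>\<^sub>F x in M. \<not> P x \<longrightarrow> (\<forall>\<^sub>F y in q. B (x + y))" "\<not> eventually B e"
        by (auto simp: le_filter_def eventually_filter_plus eventually_inf_principal)
      have "\<forall>\<^sub>F x in M. \<forall>\<^sub>F y in q. A (x + y) \<or> B (x + y)"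
        using A(1) B(1)
      proof eventually_elim
        case (elim x)
        show ?case
        proof (cases "P x")
          case True
          then have "\<forall>\<^sub>F y in q. A (x + y)" using elim(1) by blast
          then show ?thesis by eventually_elim blast
        next
          case False
          then have "\<forall>\<^sub>F y in q. B (x + y)" using elim(2) by blast
          then show ?thesis by eventually_elim blast
        qed
      qed
      then have "\<forall>\<^sub>F x in e. A x \<or> B x"
        using M(2) by (simp add: le_filter_def eventually_filter_plus)
      moreover have "\<forall>\<^sub>F x in e. \<not> A x" "\<forall>\<^sub>F x in e. \<not> B x"
        using A(2) B(2) ultra_not_eventually[OF assms(1)] by auto
      ultimately have "\<forall>\<^sub>F x in e. False" by eventually_elim auto
      then show False using ultra_neq_bot[OF assms(1)] by (simp add: trivial_limit_def)
    qed
    then show "inf M (principal {x. P x}) = M \<or> inf M (principal {x. \<not> P x}) = M"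
      using min by (metis inf_le1)
  qed
  then show thesis
    using that[of M] M ultra_minimal[OF ultra_filter_plus, of M q e] assms ultra_neq_bot by blast
qed

text \<open>The Ellis--Numakura lemma: a filter \<open>F\<close> represents the closed set of ultrafilters below it.\<close>

lemma idempotent_ultra_exists:
  assumes "S \<noteq> bot" "S \<oplus> S \<le> S"
  obtains q where "q \<le> S" "ultra q" "q \<oplus> q = q"
proof -
  obtain F where F: "F \<le> S" "F \<noteq> bot" "F \<oplus> F \<le> F"
    and min: "\<And>N. N \<le> F \<Longrightarrow> N \<noteq> bot \<Longrightarrow> N \<oplus> N \<le> N \<Longrightarrow> N = F"
  proof (rule minimal_filter_exists[of "\<lambda>F. F \<noteq> bot \<and> F \<oplus> F \<le> F" S])
    fix C :: "'a filter set"
    assume C: "C \<noteq> {}" "\<And>F. F \<in> C \<Longrightarrow> F \<noteq> bot \<and> F \<oplus> F \<le> F"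
      "\<forall>F\<in>C. \<forall>G\<in>C. F \<le> G \<or> G \<le> F"
    have "Inf C \<oplus> Inf C \<le> F" if "F \<in> C" for F
      using filter_plus_mono[OF Inf_lower Inf_lower, OF that that] C(2)[OF that] order_trans by blast
    then show "Inf C \<noteq> bot \<and> Inf C \<oplus> Inf C \<le> Inf C"
      using Inf_chain_neq_bot[OF C(1,3)] C(2) by (auto intro: Inf_greatest)
  qed (use assms in auto)
  obtain q where q: "q \<le> F" "ultra q" using ultra_exists F(2) by blast
  \<comment> \<open>\<open>F \<oplus> q\<close> is again a closed subsemigroup inside
    \<open>F\<close>.\<close>
  have Fq: "F \<oplus> q = F"
  proof (rule min)
    show "F \<oplus> q \<le> F" using filter_plus_mono[OF order_refl[of F] q(1)] F(3) by order
    show "F \<oplus> q \<noteq> bot" using filter_plus_neq_bot F(2) q(2) ultra_neq_bot by blast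
    have "F \<oplus> q \<oplus> F \<le> F"
      using filter_plus_mono[OF \<open>F \<oplus> q \<le> F\<close> order_refl[of F]] F(3) by order
    then show "F \<oplus> q \<oplus> (F \<oplus> q) \<le> F \<oplus> q"
      unfolding filter_plus_assoc[symmetric] by (intro filter_plus_mono) auto
  qed
  \<comment> \<open>\<open>H\<close> represents the closed subsemigroup of solutions
    \<open>i\<close> below \<open>F\<close> of \<open>i \<oplus> q = q\<close>. A solution exists
    because \<open>q\<close> lies below \<open>F \<oplus> q\<close>.\<close>
  define H where "H = Sup {G. G \<le> F \<and> G \<oplus> q \<le> q}"
  have "H = F"
  proof (rule min)
    show "H \<le> F" unfolding H_def by (rule Sup_least) auto
    have Hq: "H \<oplus> q \<le> q"
      by (auto simp: le_filter_def eventually_filter_plus H_def eventually_Sup)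
    show "H \<noteq> bot"
    proof -
      obtain i where "ultra i" "i \<le> F" "q = i \<oplus> q"
        using ultra_le_filter_plusE[of q q F] q Fq by metis
      then have "i \<le> H" unfolding H_def by (auto intro: Sup_upper)
      then show ?thesis using \<open>ultra i\<close> ultra_neq_bot bot_unique by blast
    qed
    have "H \<oplus> H \<le> F"
      using filter_plus_mono[OF \<open>H \<le> F\<close> \<open>H \<le> F\<close>] F(3) by order
    moreover have "H \<oplus> H \<oplus> q \<le> q"
      unfolding filter_plus_assoc using filter_plus_mono[OF order_refl[of H] Hq] Hq by order
    ultimately show "H \<oplus> H \<le> H" unfolding H_def by (auto intro: Sup_upper)
  qed
  moreover have "H \<oplus> q \<le> q"
    by (auto simp: le_filter_def eventually_filter_plus H_def eventually_Sup)
  \<comment> \<open>\<open>F = F \<oplus> q = H \<oplus> q \<le> q\<close>, so the minimal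
    subsemigroup consists of \<open>q\<close> alone.\<close>
  ultimately have "F = q" using Fq q(1) by auto
  then have "q \<oplus> q = q"
    using F(3) q(2) ultra_minimal filter_plus_neq_bot ultra_neq_bot by metis
  then show thesis using that[of q] q \<open>F = q\<close> F(1) by blast
qed

text \<open>Any idempotent \<open>p\<close> of a minimal closed left ideal \<open>L\<close> works.
  An idempotent \<open>x = x \<oplus> p\<close> lies in \<open>L\<close>, so minimality gives
  \<open>Q \<oplus> x = L\<close> and thus \<open>p = y \<oplus> x\<close> for some
  \<open>y\<close>; then \<open>p \<oplus> x = p\<close>, whereas \<open>p \<oplus> x = x\<close> by
  assumption.\<close>

lemma minimal_idempotent_exists:
  assumes "Q \<noteq> bot" "Q \<oplus> Q \<le> Q"
  obtains p where "p \<le> Q" "ultra p" "p \<oplus> p = p"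
    "\<And>x. x \<le> Q \<Longrightarrow> ultra x \<Longrightarrow> x \<oplus> x = x \<Longrightarrow> x \<oplus> p = x \<Longrightarrow> p \<oplus> x = x \<Longrightarrow> x = p"
proof -
  obtain L where L: "L \<le> Q" "L \<noteq> bot" "Q \<oplus> L \<le> L"
    and min: "\<And>N. N \<le> L \<Longrightarrow> N \<noteq> bot \<Longrightarrow> Q \<oplus> N \<le> N \<Longrightarrow> N = L"
  proof (rule minimal_filter_exists[of "\<lambda>F. F \<noteq> bot \<and> Q \<oplus> F \<le> F" Q])
    fix C :: "'a filter set"
    assume C: "C \<noteq> {}" "\<And>F. F \<in> C \<Longrightarrow> F \<noteq> bot \<and> Q \<oplus> F \<le> F"
      "\<forall>F\<in>C. \<forall>G\<in>C. F \<le> G \<or> G \<le> F"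
    have "Q \<oplus> Inf C \<le> F" if "F \<in> C" for F
      using filter_plus_mono[OF order_refl Inf_lower, OF that] C(2)[OF that] order_trans by blast
    then show "Inf C \<noteq> bot \<and> Q \<oplus> Inf C \<le> Inf C"
      using Inf_chain_neq_bot[OF C(1,3)] C(2) by (auto intro: Inf_greatest)
  qed (use assms in auto)
  have "L \<oplus> L \<le> L" using filter_plus_mono[OF L(1) order_refl[of L]] L(3) by order
  then obtain p where p: "p \<le> L" "ultra p" "p \<oplus> p = p"
    using idempotent_ultra_exists L(2) by blast
  show thesis
  proof (rule that[OF _ p(2,3)])
    show "p \<le> Q" using p(1) L(1) by order
    fix x assume x: "x \<le> Q" "ultra x" "x \<oplus> x = x" "x \<oplus> p = x" "p \<oplus> x = x"
    have "x \<le> L" using filter_plus_mono[OF x(1) p(1)] x(4) L(3) by order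
    have "Q \<oplus> x = L"
    proof (rule min)
      show "Q \<oplus> x \<le> L" using filter_plus_mono[OF order_refl[of Q] \<open>x \<le> L\<close>] L(3) by order
      show "Q \<oplus> x \<noteq> bot" using filter_plus_neq_bot assms(1) ultra_neq_bot x(2) by blast
      show "Q \<oplus> (Q \<oplus> x) \<le> Q \<oplus> x"
        unfolding filter_plus_assoc[symmetric] by (intro filter_plus_mono assms(2)) auto
    qed
    then obtain y where "p = y \<oplus> x"
      using ultra_le_filter_plusE[OF p(2) x(2), of Q] p(1) by blast
    then have "p \<oplus> x = p" using x(3) by (simp add: filter_plus_assoc)
    then show "x = p" using x(5) by simp
  qed
qed

text \<open>A minimal idempotent \<open>p\<close>, embedded diagonally in a subsemigroup \<open>E\<close> of a product, lies in
  every ideal \<open>I\<close> of \<open>E\<close> as far as the projections can see.\<close>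

lemma ideal_filter_over_minimal_idempotent:
  fixes p Q :: "'a::semigroup_add filter" and E I :: "'b::semigroup_add filter"
  assumes p: "ultra p" "p \<oplus> p = p"
    and min: "\<And>x. x \<le> Q \<Longrightarrow> ultra x \<Longrightarrow> x \<oplus> x = x \<Longrightarrow> x \<oplus> p = x \<Longrightarrow> p \<oplus> x = x \<Longrightarrow> x = p"
    and d: "\<And>x y. d (x + y) = d x + d y" "filtermap d p \<le> E"
    and I: "I \<le> E" "I \<noteq> bot" "I \<oplus> E \<le> I" "E \<oplus> I \<le> I"
  obtains f where "f \<le> I" "f \<noteq> bot"
    "\<And>\<pi>. (\<And>v w. \<pi> (v + w) = \<pi> v + \<pi> w) \<Longrightarrow> (\<And>x. \<pi> (d x) = x) \<Longrightarrow> filtermap \<pi> E \<le> Q \<Longrightarrow>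
      filtermap \<pi> f = p"
proof -
  define dp where "dp = filtermap d p"
  have dp: "ultra dp" "dp \<oplus> dp = dp" "dp \<le> E"
    using p d by (auto simp: dp_def ultra_filtermap filtermap_filter_plus[symmetric])
  have IE: "X \<oplus> Y \<le> I" if "X \<le> I" "Y \<le> E" for X Y
    using filter_plus_mono[OF that] I(3) by order
  have EI: "X \<oplus> Y \<le> I" if "X \<le> E" "Y \<le> I" for X Y
    using filter_plus_mono[OF that] I(4) by order
  \<comment> \<open>\<open>I \<oplus> dp\<close> is a subsemigroup whose ultrafilters all end in
    \<open>dp\<close>, so an idempotent \<open>e\<close> of it is fixed by adding \<open>dp\<close>
    on the right.\<close>
  have "I \<oplus> dp \<oplus> (I \<oplus> dp) \<le> I \<oplus> dp"
    unfolding filter_plus_assoc[symmetric]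
    by (intro filter_plus_mono IE[of "I \<oplus> dp"] IE[of I] I dp order_refl)
  moreover have "I \<oplus> dp \<noteq> bot"
    using I(2) dp(1) filter_plus_neq_bot ultra_neq_bot by blast
  ultimately obtain e where e: "e \<le> I \<oplus> dp" "ultra e" "e \<oplus> e = e"
    using idempotent_ultra_exists by blast
  obtain i where "e = i \<oplus> dp"
    using ultra_le_filter_plusE[OF e(2) dp(1) e(1)] by blast
  then have edp: "e \<oplus> dp = e"
    using dp(2) by (simp add: filter_plus_assoc)
  have "e \<le> I" using e(1) IE[OF order_refl dp(3)] by order
  \<comment> \<open>Adding \<open>dp\<close> on the left as well makes \<open>f\<close> absorb
    \<open>dp\<close> on both sides, and \<open>f\<close> stays idempotent.\<close>
  define f where "f = dp \<oplus> e"
  have f: "ultra f"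
    unfolding f_def using dp(1) e(2) by (rule ultra_filter_plus)
  have f_plus: "dp \<oplus> f = f" "f \<oplus> dp = f"
    by (simp_all add: f_def filter_plus_assoc edp) (simp add: dp(2) flip: filter_plus_assoc)
  have f_idem: "f \<oplus> f = f"
    using f_plus(2) by (metis f_def e(3) filter_plus_assoc)
  have "f \<le> I" unfolding f_def by (intro EI dp \<open>e \<le> I\<close>)
  show thesis
  proof (rule that[OF \<open>f \<le> I\<close> ultra_neq_bot[OF f]])
    fix \<pi> :: "'b \<Rightarrow> 'a"
    assume \<pi>: "\<And>v w. \<pi> (v + w) = \<pi> v + \<pi> w" "\<And>x. \<pi> (d x) = x" "filtermap \<pi> E \<le> Q"
    have \<pi>dp: "filtermap \<pi> dp = p"
      by (simp add: dp_def filtermap_filtermap \<pi>(2))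
    \<comment> \<open>The image of \<open>f\<close> is an idempotent that absorbs \<open>p\<close>
      on both sides, so minimality of \<open>p\<close> applies.\<close>
    show "filtermap \<pi> f = p"
    proof (rule min)
      have "filtermap \<pi> f \<le> filtermap \<pi> E"
        by (rule filtermap_mono) (use \<open>f \<le> I\<close> I(1) in order)
      then show "filtermap \<pi> f \<le> Q" using \<pi>(3) by order
      show "ultra (filtermap \<pi> f)" by (rule ultra_filtermap[OF f])
    qed (simp_all add: \<pi>dp[symmetric] filtermap_filter_plus[OF \<pi>(1), symmetric] f_idem f_plus)
  qed
qed

section \<open>From idempotents to chains\<close>

text \<open>In \<open>tensor_section p r k D x\<close>, \<open>D\<close> is a set of \<open>(k + r)\<close>-tuples and \<open>r\<close> counts the coordinates
  that remain to be quantified after the \<open>k\<close> coordinates of \<open>x\<close>.\<close>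

primrec tensor_section ::
  "nat set set \<Rightarrow> nat \<Rightarrow> nat \<Rightarrow> (nat \<Rightarrow> nat) set \<Rightarrow> (nat \<Rightarrow> nat) \<Rightarrow> bool" where
  "tensor_section p 0 k D x \<longleftrightarrow> x \<in> D"
| "tensor_section p (Suc r) k D x \<longleftrightarrow>
     {y \<in> Npos. tensor_section p r (Suc k) D (x(Suc k := y))} \<in> p"

lemma tuples_0: "tuples 0 = {\<lambda>_. undefined}"
  by (simp add: tuples_def)

lemma tuples_upd: "x \<in> tuples k \<Longrightarrow> y \<in> Npos \<Longrightarrow> x(Suc k := y) \<in> tuples (Suc k)"
  by (auto simp: tuples_def PiE_def extensional_def)

text \<open>The value chosen for 0-tuples makes the base case an instance of the recursion
  step.\<close>

lemma mem_uf_tensor_Suc: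
  "A \<in> uf_tensor p (Suc k) \<longleftrightarrow>
     A \<subseteq> tuples (Suc k) \<and>
     {x \<in> tuples k. {y \<in> Npos. x(Suc k := y) \<in> A} \<in> p (Suc k)} \<in> uf_tensor p k"
proof (cases k)
  case 0
  have "(\<lambda>_. undefined)(Suc 0 := y) = (\<lambda>i\<in>{1..1}. y)" for y :: nat
    by auto
  moreover have "{x \<in> tuples 0. P x} = tuples 0 \<longleftrightarrow> P (\<lambda>_. undefined)" for P
    by (auto simp: tuples_0)
  ultimately show ?thesis by (simp only: 0 uf_tensor.simps singleton_iff One_nat_def mem_Collect_eq)
next
  case (Suc l)
  then show ?thesis by (simp only: uf_tensor.simps mem_Collect_eq)
qed

text \<open>Both notions express the same nested quantifiers: \<open>uf_tensor\<close> unfolds them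
  from the last, innermost coordinate, \<open>tensor_section\<close> from the outermost remaining
  one.\<close>

lemma mem_uf_tensor_iff_section:
  assumes "D \<subseteq> tuples (k + r)"
  shows "D \<in> uf_tensor (\<lambda>_. p) (k + r) \<longleftrightarrow>
    {x \<in> tuples k. tensor_section p r k D x} \<in> uf_tensor (\<lambda>_. p) k"
  using assms
proof (induction r arbitrary: k)
  case 0
  then have "{x \<in> tuples k. x \<in> D} = D" by auto
  then show ?case by simp
next
  case (Suc r)
  let ?D' = "{x \<in> tuples (Suc k). tensor_section p r (Suc k) D x}"
  have *: "{y \<in> Npos. x(Suc k := y) \<in> ?D'} = {y \<in> Npos. tensor_section p r (Suc k) D (x(Suc k := y))}"
    if "x \<in> tuples k" for x
    using tuples_upd[OF that] by blast
  have "D \<in> uf_tensor (\<lambda>_. p) (k + Suc r) \<longleftrightarrow> ?D' \<in> uf_tensor (\<lambda>_. p) (Suc k)"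
    using Suc.IH[of "Suc k"] Suc.prems by (simp only: add_Suc add_Suc_right)
  also have "\<dots> \<longleftrightarrow> {x \<in> tuples k. {y \<in> Npos. x(Suc k := y) \<in> ?D'} \<in> p} \<in> uf_tensor (\<lambda>_. p) k"
    unfolding mem_uf_tensor_Suc by blast
  also have "{x \<in> tuples k. {y \<in> Npos. x(Suc k := y) \<in> ?D'} \<in> p} =
      {x \<in> tuples k. tensor_section p (Suc r) k D x}"
    using * by (auto simp only: tensor_section.simps)
  finally show ?case .
qed

corollary mem_uf_tensor_iff:
  assumes "D \<subseteq> tuples m"
  shows "D \<in> uf_tensor (\<lambda>_. p) m \<longleftrightarrow> tensor_section p m 0 D (\<lambda>_. undefined)"
  using mem_uf_tensor_iff_section[of D 0 m p] assms by (auto simp: tuples_0)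

section \<open>Members of an ultrafilter and the J-set property\<close>

lemma ultrafilter_on_Int: "ultrafilter_on X p \<Longrightarrow> A \<in> p \<Longrightarrow> B \<in> p \<Longrightarrow> A \<inter> B \<in> p"
  by (simp add: ultrafilter_on_def)

lemma ultrafilter_on_finite_Inter:
  assumes "ultrafilter_on X p" "finite I" "\<And>i. i \<in> I \<Longrightarrow> B i \<in> p"
  shows "{y \<in> X. \<forall>i\<in>I. y \<in> B i} \<in> p"
  using assms(2,3)
proof (induction I)
  case empty
  then show ?case using assms(1) by (simp add: ultrafilter_on_def)
next
  case (insert i I)
  have "{y \<in> X. \<forall>i\<in>insert i I. y \<in> B i} = B i \<inter> {y \<in> X. \<forall>i\<in>I. y \<in> B i}"
    using insert.prems[of i] assms(1) by (auto simp: ultrafilter_on_def)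
  then show ?case using insert ultrafilter_on_Int[OF assms(1)] by simp
qed

text \<open>Apply the J-set property to the functions shifted by \<open>n\<close> and add
  \<open>n\<close> to the indices found. This secures condition (a) of (1) in the recursion.\<close>

lemma J_set_beyond:
  assumes "J_set D" "F \<in> Pf Npos_fun"
  obtains a B where "a \<in> Npos" "B \<in> Pf Npos" "\<And>t. t \<in> B \<Longrightarrow> n < t"
    "\<And>f. f \<in> F \<Longrightarrow> a + (\<Sum>t\<in>B. f t) \<in> D"
proof -
  define sh where "sh f = (\<lambda>t\<in>Npos. f (t + n))" for f :: "nat \<Rightarrow> nat"
  have "sh ` F \<in> Pf Npos_fun"
    using assms(2) by (auto simp: Pf_def sh_def Npos_fun_def Npos_def PiE_def Pi_def)
  then obtain a B where aB: "a \<in> Npos" "B \<in> Pf Npos" "\<forall>f\<in>sh ` F. a + (\<Sum>t\<in>B. f t) \<in> D"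
    using assms(1) unfolding J_set_def by blast
  show thesis
  proof (rule that[of a "(\<lambda>t. t + n) ` B"])
    show "(\<lambda>t. t + n) ` B \<in> Pf Npos" "\<And>t. t \<in> (\<lambda>t. t + n) ` B \<Longrightarrow> n < t"
      using aB(2) by (auto simp: Pf_def Npos_def)
    fix f assume "f \<in> F"
    have "(\<Sum>t\<in>(\<lambda>t. t + n) ` B. f t) = (\<Sum>t\<in>B. sh f t)"
      using aB(2) by (subst sum.reindex) (auto simp: Pf_def sh_def intro!: sum.cong)
    then show "a + (\<Sum>t\<in>(\<lambda>t. t + n) ` B. f t) \<in> D"
      using aB(3) \<open>f \<in> F\<close> by auto
  qed (use aB in auto)
qed

text \<open>For \<open>k = m\<close> the second conjunct says that \<open>x k\<close> lies in the star set
  \<open>{y \<in> C. - y + C \<in> p}\<close> of the section \<open>C\<close> of \<open>D\<close>.\<close>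

definition extendable :: "nat set set \<Rightarrow> nat \<Rightarrow> (nat \<Rightarrow> nat) set \<Rightarrow> nat \<Rightarrow> (nat \<Rightarrow> nat) \<Rightarrow> bool" where
  "extendable p m D k x \<longleftrightarrow> tensor_section p (m - k) k D x \<and>
     (0 < k \<longrightarrow> {y \<in> Npos. tensor_section p (m - k) k D (x(k := x k + y))} \<in> p)"

text \<open>Since \<open>p = p + p\<close>, a set \<open>C\<close> in \<open>p\<close> has
  \<open>- x + C\<close> in \<open>p\<close> for \<open>p\<close>-most \<open>x\<close>; intersect
  with \<open>C\<close>.\<close>

lemma idempotent_star:
  assumes "ultrafilter_on Npos p" "uf_idempotent p" "{y \<in> Npos. P y} \<in> p"
  shows "{y \<in> Npos. P y \<and> {z \<in> Npos. P (y + z)} \<in> p} \<in> p"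
proof -
  have "{y \<in> Npos. P y} \<in> uf_plus p p"
    using assms(2,3) by (simp add: uf_idempotent_def)
  then have "{x \<in> Npos. {y \<in> Npos. x + y \<in> {y \<in> Npos. P y}} \<in> p} \<in> p"
    by (simp add: uf_plus_def)
  moreover have "{y \<in> Npos. x + y \<in> {y \<in> Npos. P y}} = {y \<in> Npos. P (x + y)}" for x
    by (auto simp: Npos_def)
  ultimately have "{x \<in> Npos. {y \<in> Npos. P (x + y)} \<in> p} \<in> p" by simp
  moreover have "{y \<in> Npos. P y \<and> {z \<in> Npos. P (y + z)} \<in> p} =
      {y \<in> Npos. P y} \<inter> {x \<in> Npos. {y \<in> Npos. P (x + y)} \<in> p}" by auto
  ultimately show ?thesis using ultrafilter_on_Int[OF assms(1,3)] by simp
qed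

text \<open>The second conjunct of \<open>extendable\<close> puts a set into \<open>p\<close>.
  Taking \<open>y\<close> from the star set of that set preserves the second conjunct.\<close>

lemma extendable_add:
  assumes "ultrafilter_on Npos p" "uf_idempotent p" "extendable p m D k x" "0 < k"
  shows "{y \<in> Npos. extendable p m D k (x(k := x k + y))} \<in> p"
  using idempotent_star[OF assms(1,2), of "\<lambda>y. tensor_section p (m - k) k D (x(k := x k + y))"] assms(3,4)
  by (simp add: extendable_def add.assoc)

text \<open>For \<open>k < m\<close> the first conjunct says that \<open>p\<close>-most values are
  admissible as coordinate \<open>k + 1\<close>; the star set of these values provides the second
  conjunct for the new block.\<close>

lemma extendable_new:
  assumes "ultrafilter_on Npos p" "uf_idempotent p" "extendable p m D k x" "k < m"
  shows "{y \<in> Npos. extendable p m D (Suc k) (x(Suc k := y))} \<in> p"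
proof -
  have eq: "m - k = Suc (m - Suc k)" using assms(4) by simp
  have "{y \<in> Npos. tensor_section p (m - Suc k) (Suc k) D (x(Suc k := y))} \<in> p"
    using assms(3) unfolding extendable_def eq tensor_section.simps by blast
  from idempotent_star[OF assms(1,2) this] show ?thesis
    by (simp add: extendable_def)
qed

text \<open>A state \<open>(k, x) \<in> S F\<close> is a \<open>k\<close>-tuple of block sums along a chain whose largest
  set is \<open>F\<close>, the last block still being open.\<close>

lemma extendable_choice_exists:
  assumes p: "p \<in> J_ultrafilters" "uf_idempotent p" and D: "tensor_section p m 0 D (\<lambda>_. undefined)"
  obtains \<alpha> H S where
    "\<And>F. F \<in> Pf Npos_fun \<Longrightarrow> \<alpha> F \<in> Npos"
    "\<And>F. F \<in> Pf Npos_fun \<Longrightarrow> H F \<in> Pf Npos"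
    "\<And>F G s t. F \<in> Pf Npos_fun \<Longrightarrow> G \<in> Pf Npos_fun \<Longrightarrow> F \<subset> G \<Longrightarrow> s \<in> H F \<Longrightarrow> t \<in> H G \<Longrightarrow> s < t"
    "(0, \<lambda>_. undefined) \<in> S {}"
    "\<And>F k x. F \<in> Pf Npos_fun \<Longrightarrow> (k, x) \<in> S F \<Longrightarrow> extendable p m D k x"
    "\<And>F G f k x. G \<in> Pf Npos_fun \<Longrightarrow> F \<subset> G \<Longrightarrow> f \<in> G \<Longrightarrow> (k, x) \<in> S F \<Longrightarrow> 0 < k \<Longrightarrow>
      (k, x(k := x k + (\<alpha> G + (\<Sum>t\<in>H G. f t)))) \<in> S G"
    "\<And>F G f k x. G \<in> Pf Npos_fun \<Longrightarrow> F \<subset> G \<Longrightarrow> f \<in> G \<Longrightarrow> (k, x) \<in> S F \<Longrightarrow> k < m \<Longrightarrow>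
      (Suc k, x(Suc k := \<alpha> G + (\<Sum>t\<in>H G. f t))) \<in> S G"
proof -
  have uf: "ultrafilter_on Npos p" and J: "\<And>A. A \<in> p \<Longrightarrow> J_set A"
    using p(1) by (auto simp: J_ultrafilters_def stone_cech_def)
  \<comment> \<open>\<open>\<Phi> g G\<close> specifies the triple of \<open>\<alpha> G\<close>,
    \<open>H G\<close> and \<open>S G\<close> in terms of the values of \<open>g\<close> at proper
    subsets of \<open>G\<close>; it is vacuous unless \<open>G\<close> is a finite set of
    functions.\<close>
  define \<Phi> :: "((nat \<Rightarrow> nat) set \<Rightarrow> nat \<times> nat set \<times> (nat \<times> (nat \<Rightarrow> nat)) set) \<Rightarrow> (nat \<Rightarrow> nat) set \<Rightarrow>
      nat \<times> nat set \<times> (nat \<times> (nat \<Rightarrow> nat)) set \<Rightarrow> bool"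
    where "\<Phi> g G = (\<lambda>(a, B, S). finite G \<and> G \<subseteq> Npos_fun \<longrightarrow>
      a \<in> Npos \<and> B \<in> Pf Npos \<and> finite S \<and> (G = {} \<longrightarrow> (0, \<lambda>_. undefined) \<in> S) \<and>
      (\<forall>(k, x)\<in>S. extendable p m D k x) \<and>
      (\<forall>F. F \<subset> G \<longrightarrow> (\<forall>s\<in>fst (snd (g F)). \<forall>t\<in>B. s < t) \<and>
        (\<forall>f\<in>G. \<forall>k x. (k, x) \<in> snd (snd (g F)) \<longrightarrow>
          (0 < k \<longrightarrow> (k, x(k := x k + (a + (\<Sum>t\<in>B. f t)))) \<in> S) \<and>
          (k < m \<longrightarrow> (Suc k, x(Suc k := a + (\<Sum>t\<in>B. f t))) \<in> S))))" for g G
  have "\<exists>g. \<forall>G. \<Phi> g G (g G)"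
  proof (rule dependent_wf_choice[OF wf_finite_psubset])
    fix f g :: "(nat \<Rightarrow> nat) set \<Rightarrow> nat \<times> nat set \<times> (nat \<times> (nat \<Rightarrow> nat)) set" and G r
    assume eq: "\<And>z. (z, G) \<in> finite_psubset \<Longrightarrow> f z = g z"
    show "\<Phi> f G r = \<Phi> g G r"
    \<comment> \<open>\<open>finite_psubset\<close> has only finite sets on the larger side, so an
      infinite \<open>G\<close> is treated apart; there \<Phi> holds trivially.\<close>
    proof (cases "finite G")
      case True
      then have "f F = g F" if "F \<subset> G" for F using eq that by (simp add: finite_psubset_def)
      then show ?thesis by (simp add: \<Phi>_def cong: imp_cong)
    qed (simp add: \<Phi>_def)
  next
    fix G and g :: "(nat \<Rightarrow> nat) set \<Rightarrow> nat \<times> nat set \<times> (nat \<times> (nat \<Rightarrow> nat)) set"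
    assume "\<And>F. (F, G) \<in> finite_psubset \<Longrightarrow> \<Phi> g F (g F)"
    then have IH: "finite G \<Longrightarrow> F \<subset> G \<Longrightarrow> \<Phi> g F (g F)" for F by (simp add: finite_psubset_def)
    consider "\<not> (finite G \<and> G \<subseteq> Npos_fun)" | "G = {}" | "G \<in> Pf Npos_fun"
      by (auto simp: Pf_def)
    then show "\<exists>r. \<Phi> g G r"
    proof cases
      case 1
      then show ?thesis by (auto simp: \<Phi>_def)
    next
      case 2
      \<comment> \<open>The empty set carries the initial state; 1 and \<open>{1}\<close> are
        default values, since the empty set lies outside \<open>Pf Npos_fun\<close>.\<close>
      have "\<Phi> g G (1, {1}, {(0, \<lambda>_. undefined)})"
        using D by (simp add: \<Phi>_def 2 Npos_def Pf_def extendable_def)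
      then show ?thesis ..
    next
      case 3
      then have G: "finite G" "G \<subseteq> Npos_fun" "G \<noteq> {}" by (auto simp: Pf_def)
      \<comment> \<open>All states and all indices used below \<open>G\<close>; there are finitely
        many, because \<open>G\<close> has finitely many subsets.\<close>
      define Q where "Q = (\<Union>F\<in>{F. F \<subset> G}. snd (snd (g F)))"
      define N where "N = (\<Union>F\<in>{F. F \<subset> G}. fst (snd (g F)))"
      have sub: "finite (fst (snd (g F))) \<and> finite (snd (snd (g F))) \<and>
          (\<forall>(k, x)\<in>snd (snd (g F)). extendable p m D k x)" if "F \<subset> G" for F
        using IH[OF G(1) that] that G finite_subset[of F G]
        by (cases "g F") (auto simp: \<Phi>_def Pf_def)
      have fin: "finite {F. F \<subset> G}"
        using G(1) by (rule rev_finite_subset[OF finite_Pow_iff[THEN iffD2]]) auto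
      then have "finite Q" "finite N" using sub by (auto simp: Q_def N_def)
      have Q: "extendable p m D k x" if "(k, x) \<in> Q" for k x
        using sub that by (auto simp: Q_def)
      \<comment> \<open>\<open>C (k, x)\<close> collects the numbers that keep the state extendable
        both when added to the open block and when starting a new one, as far as \<open>k\<close>
        permits either.\<close>
      define C where "C = (\<lambda>(k, x). {y \<in> Npos.
        (0 < k \<longrightarrow> extendable p m D k (x(k := x k + y))) \<and>
        (k < m \<longrightarrow> extendable p m D (Suc k) (x(Suc k := y)))})"
      have "C s \<in> p" if sQ: "s \<in> Q" for s
      proof -
        obtain k x where s: "s = (k, x)" by fastforce
        let ?A = "{y \<in> Npos. 0 < k \<longrightarrow> extendable p m D k (x(k := x k + y))}"
        let ?B = "{y \<in> Npos. k < m \<longrightarrow> extendable p m D (Suc k) (x(Suc k := y))}"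
        have "Npos \<in> p" using uf by (simp add: ultrafilter_on_def)
        then have "?A \<in> p" "?B \<in> p"
          using extendable_add[OF uf p(2), of m D k x] extendable_new[OF uf p(2), of m D k x]
            Q[of k x] sQ s by (cases "0 < k"; cases "k < m"; simp)+
        moreover have "C s = ?A \<inter> ?B" by (auto simp: C_def s)
        ultimately show ?thesis using ultrafilter_on_Int[OF uf] by simp
      qed
      then have "J_set {y \<in> Npos. \<forall>s\<in>Q. y \<in> C s}"
        by (intro J ultrafilter_on_finite_Inter uf \<open>finite Q\<close>)
      then obtain a B where aB: "a \<in> Npos" "B \<in> Pf Npos" "\<And>t. t \<in> B \<Longrightarrow> Max (insert 0 N) < t"
        "\<And>f. f \<in> G \<Longrightarrow> a + (\<Sum>t\<in>B. f t) \<in> {y \<in> Npos. \<forall>s\<in>Q. y \<in> C s}"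
        by (rule J_set_beyond[OF _ 3]) blast
      have lt: "s < t" if "s \<in> N" "t \<in> B" for s t
        using aB(3)[OF that(2)] Max_ge[of "insert 0 N" s] \<open>finite N\<close> that(1) by simp
      define add new where "add = (\<lambda>((k::nat, x), f). (k, x(k := x k + (a + (\<Sum>t\<in>B. f t)))))"
        and "new = (\<lambda>((k::nat, x), f). (Suc k, x(Suc k := a + (\<Sum>t\<in>B. f t))))"
      \<comment> \<open>Each earlier state is continued by one summand, for every function in
        \<open>G\<close>.\<close>
      define S where "S = add ` {s \<in> Q \<times> G. 0 < fst (fst s)} \<union> new ` {s \<in> Q \<times> G. fst (fst s) < m}"
      have "\<Phi> g G (a, B, S)"
        unfolding \<Phi>_def prod.case
      proof (intro impI conjI allI ballI)
        show "finite S" using \<open>finite Q\<close> G(1) by (simp add: S_def)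
        show "case s of (k, x) \<Rightarrow> extendable p m D k x" if "s \<in> S" for s
          using that aB(4) by (fastforce simp: S_def add_def new_def C_def)
        show "s < t" if "F \<subset> G" "s \<in> fst (snd (g F))" "t \<in> B" for F s t
          using lt that by (auto simp: N_def)
        fix F f k x assume *: "F \<subset> G" "f \<in> G" "(k, x) \<in> snd (snd (g F))"
        then have "((k, x), f) \<in> Q \<times> G" by (auto simp: Q_def)
        then show "(k, x(k := x k + (a + (\<Sum>t\<in>B. f t)))) \<in> S" if "0 < k"
          using that unfolding S_def by (intro UnI1 image_eqI[of _ _ "((k, x), f)"]) (auto simp: add_def)
        show "(Suc k, x(Suc k := a + (\<Sum>t\<in>B. f t))) \<in> S" if "k < m"
          using that \<open>_ \<in> Q \<times> G\<close> unfolding S_def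
          by (intro UnI2 image_eqI[of _ _ "((k, x), f)"]) (auto simp: new_def)
      qed (use aB G in auto)
      then show ?thesis ..
    qed
  qed
  then obtain g where g: "\<And>G. \<Phi> g G (g G)" by blast
  have gD: "fst (g G) \<in> Npos \<and> fst (snd (g G)) \<in> Pf Npos \<and> (G = {} \<longrightarrow> (0, \<lambda>_. undefined) \<in> snd (snd (g G))) \<and>
      (\<forall>(k, x)\<in>snd (snd (g G)). extendable p m D k x) \<and>
      (\<forall>F. F \<subset> G \<longrightarrow> (\<forall>s\<in>fst (snd (g F)). \<forall>t\<in>fst (snd (g G)). s < t) \<and>
        (\<forall>f\<in>G. \<forall>k x. (k, x) \<in> snd (snd (g F)) \<longrightarrow>
          (0 < k \<longrightarrow> (k, x(k := x k + (fst (g G) + (\<Sum>t\<in>fst (snd (g G)). f t)))) \<in> snd (snd (g G))) \<and>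
          (k < m \<longrightarrow> (Suc k, x(Suc k := fst (g G) + (\<Sum>t\<in>fst (snd (g G)). f t))) \<in> snd (snd (g G)))))"
    if "finite G" "G \<subseteq> Npos_fun" for G
    using g[of G] that by (simp add: \<Phi>_def case_prod_beta)
  have Pf: "finite G" "G \<subseteq> Npos_fun" if "G \<in> Pf Npos_fun" for G
    using that by (auto simp: Pf_def)
  show thesis
  proof (rule that[of "\<lambda>G. fst (g G)" "\<lambda>G. fst (snd (g G))" "\<lambda>G. snd (snd (g G))"])
    show "(0, \<lambda>_. undefined) \<in> snd (snd (g {}))" using gD[of "{}"] by simp
  next
    fix F assume "F \<in> Pf Npos_fun"
    note * = gD[OF Pf, OF this this]
    show "fst (g F) \<in> Npos" "fst (snd (g F)) \<in> Pf Npos" using * by blast+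
    show "extendable p m D k x" if "(k, x) \<in> snd (snd (g F))" for k x using * that by blast
  next
    fix F G assume "G \<in> Pf Npos_fun" and FG: "F \<subset> G"
    note * = gD[OF Pf, OF this(1) this(1), THEN conjunct2, THEN conjunct2, THEN conjunct2,
        THEN conjunct2, rule_format, OF FG]
    show "s < t" if "s \<in> fst (snd (g F))" "t \<in> fst (snd (g G))" for s t
      using * that by blast
    fix f k x assume f: "f \<in> G" "(k, x) \<in> snd (snd (g F))"
    show "(k, x(k := x k + (fst (g G) + (\<Sum>t\<in>fst (snd (g G)). f t)))) \<in> snd (snd (g G))" if "0 < k"
      using * f that by blast
    show "(Suc k, x(Suc k := fst (g G) + (\<Sum>t\<in>fst (snd (g G)). f t))) \<in> snd (snd (g G))" if "k < m"
      using * f that by blast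
  qed
qed

section \<open>Block sums as states\<close>

lemma block_sum_state:
  fixes y :: "nat \<Rightarrow> nat" and G :: "nat \<Rightarrow> 'a set"
  assumes "finite C" "C \<noteq> {}"
    and mono: "\<And>i j. i \<in> C \<Longrightarrow> j \<in> C \<Longrightarrow> i < j \<Longrightarrow> G i \<subset> G j"
    and new: "\<And>i. i \<in> C \<Longrightarrow> (Suc k, x(Suc k := y i)) \<in> S (G i)"
    and add: "\<And>i j x. i \<in> C \<Longrightarrow> j \<in> C \<Longrightarrow> G i \<subset> G j \<Longrightarrow> (Suc k, x) \<in> S (G i) \<Longrightarrow>
      (Suc k, x(Suc k := x (Suc k) + y j)) \<in> S (G j)"
  shows "(Suc k, x(Suc k := \<Sum>i\<in>C. y i)) \<in> S (G (Max C))"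
  using assms
proof (induction C rule: finite_linorder_max_induct)
  case (insert b C)
  have b: "b \<notin> C" using insert.hyps by auto
  show ?case
  \<comment> \<open>The first index of a block opens the coordinate; each larger index is then added
    to it.\<close>
  proof (cases "C = {}")
    case True
    then show ?thesis using insert.prems(3)[of b] by simp
  next
    case False
    then have Max: "Max C \<in> C" "Max C < b" "Max (insert b C) = b"
      using insert.hyps by (auto intro: Max_eqI less_imp_le)
    have "(Suc k, x(Suc k := \<Sum>i\<in>C. y i)) \<in> S (G (Max C))"
    proof (rule insert.IH[OF False])
      show "G i \<subset> G j" if "i \<in> C" "j \<in> C" "i < j" for i j
        using insert.prems(2) that by blast
      show "(Suc k, x(Suc k := y i)) \<in> S (G i)" if "i \<in> C" for i
        using insert.prems(3) that by blast
      show "(Suc k, x(Suc k := x (Suc k) + y j)) \<in> S (G j)"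
        if "i \<in> C" "j \<in> C" "G i \<subset> G j" "(Suc k, x) \<in> S (G i)" for i j x
        using insert.prems(4) that by blast
    qed
    with insert.prems(4)[of "Max C" b] insert.prems(2)[of "Max C" b] Max
    have "(Suc k, (x(Suc k := \<Sum>i\<in>C. y i))(Suc k := (x(Suc k := \<Sum>i\<in>C. y i)) (Suc k) + y b)) \<in> S (G b)"
      by blast
    moreover have "(x(Suc k := a))(Suc k := (x(Suc k := a)) (Suc k) + c) = x(Suc k := c + a)" for a c
      by (simp add: add.commute)
    moreover have "(\<Sum>i\<in>insert b C. y i) = y b + (\<Sum>i\<in>C. y i)"
      using insert.hyps(1) b by simp
    ultimately show ?thesis unfolding Max(3) by metis
  qed
qed simp

lemma restrict_Suc_upd: "(\<lambda>j\<in>{1..k}. g j)(Suc k := g (Suc k)) = (\<lambda>j\<in>{1..Suc k}. g j)"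
  by (auto simp: restrict_def)

lemma Max_in_Npos:
  assumes "B \<in> Pf Npos"
  shows "Max B \<in> Npos"
proof -
  have "finite B" "B \<noteq> {}" "B \<subseteq> Npos" using assms by (auto simp: Pf_def)
  then show ?thesis using Max_in by blast
qed

text \<open>Block by block, the sums along the chain form states. After the last block the state is
  an extendable \<open>m\<close>-tuple, and with no coordinate left to quantify this includes
  membership in \<open>D\<close>.\<close>

theorem configuration_if_idempotent:
  assumes "p \<in> J_ultrafilters" "uf_idempotent p" "tensor_section p m 0 D (\<lambda>_. undefined)" "0 < m"
  shows "\<exists>\<alpha> H. \<alpha> \<in> Pf Npos_fun \<rightarrow> Npos \<and> H \<in> Pf Npos_fun \<rightarrow> Pf Npos \<and>
        (\<forall>F\<in>Pf Npos_fun. \<forall>G\<in>Pf Npos_fun. F \<subset> G \<longrightarrow> Max (H F) < Min (H G)) \<and>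
        (\<forall>G :: nat \<Rightarrow> (nat \<Rightarrow> nat) set.
           (\<forall>i\<in>Npos. G i \<in> Pf Npos_fun) \<and> (\<forall>i\<in>Npos. G i \<subset> G (Suc i)) \<longrightarrow>
           (\<forall>\<beta> :: nat \<Rightarrow> nat set. \<forall>f :: nat \<Rightarrow> nat \<Rightarrow> nat.
              (\<forall>j\<in>{1..m}. \<beta> j \<in> Pf Npos) \<and> (\<forall>j\<in>{1..<m}. block_less (\<beta> j) (\<beta> (Suc j))) \<and>
              (\<forall>i\<in>Npos. f i \<in> G i) \<longrightarrow>
              (\<lambda>j\<in>{1..m}. \<Sum>i\<in>\<beta> j. \<alpha> (G i) + (\<Sum>t\<in>H (G i). f i t)) \<in> D))"
proof -
  obtain \<alpha> H S where \<alpha>: "\<And>F. F \<in> Pf Npos_fun \<Longrightarrow> \<alpha> F \<in> Npos"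
    and H: "\<And>F. F \<in> Pf Npos_fun \<Longrightarrow> H F \<in> Pf Npos"
      "\<And>F G s t. F \<in> Pf Npos_fun \<Longrightarrow> G \<in> Pf Npos_fun \<Longrightarrow> F \<subset> G \<Longrightarrow> s \<in> H F \<Longrightarrow> t \<in> H G \<Longrightarrow> s < t"
    and S0: "(0, \<lambda>_. undefined) \<in> S {}"
    and ext: "\<And>F k x. F \<in> Pf Npos_fun \<Longrightarrow> (k, x) \<in> S F \<Longrightarrow> extendable p m D k x"
    and add: "\<And>F G f k x. G \<in> Pf Npos_fun \<Longrightarrow> F \<subset> G \<Longrightarrow> f \<in> G \<Longrightarrow> (k, x) \<in> S F \<Longrightarrow> 0 < k \<Longrightarrow>
      (k, x(k := x k + (\<alpha> G + (\<Sum>t\<in>H G. f t)))) \<in> S G"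
    and new: "\<And>F G f k x. G \<in> Pf Npos_fun \<Longrightarrow> F \<subset> G \<Longrightarrow> f \<in> G \<Longrightarrow> (k, x) \<in> S F \<Longrightarrow> k < m \<Longrightarrow>
      (Suc k, x(Suc k := \<alpha> G + (\<Sum>t\<in>H G. f t))) \<in> S G"
    using extendable_choice_exists[OF assms(1-3)] by blast
  show ?thesis
  proof (intro exI[of _ \<alpha>] exI[of _ H] conjI ballI allI impI)
    fix F G assume "F \<in> Pf Npos_fun" "G \<in> Pf Npos_fun" "F \<subset> G"
    moreover from this have "Max (H F) \<in> H F" "Min (H G) \<in> H G"
      using H(1) by (auto simp: Pf_def)
    ultimately show "Max (H F) < Min (H G)" using H(2) by blast
  next
    fix G :: "nat \<Rightarrow> (nat \<Rightarrow> nat) set" and \<beta> :: "nat \<Rightarrow> nat set" and f :: "nat \<Rightarrow> nat \<Rightarrow> nat"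
    assume G: "(\<forall>i\<in>Npos. G i \<in> Pf Npos_fun) \<and> (\<forall>i\<in>Npos. G i \<subset> G (Suc i))"
      and "(\<forall>j\<in>{1..m}. \<beta> j \<in> Pf Npos) \<and> (\<forall>j\<in>{1..<m}. block_less (\<beta> j) (\<beta> (Suc j))) \<and>
              (\<forall>i\<in>Npos. f i \<in> G i)"
    then have \<beta>: "\<And>j. j \<in> {1..m} \<Longrightarrow> \<beta> j \<in> Pf Npos"
      "\<And>j. j \<in> {1..<m} \<Longrightarrow> block_less (\<beta> j) (\<beta> (Suc j))"
      and f: "\<And>i. i \<in> Npos \<Longrightarrow> f i \<in> G i" by auto
    have mono: "G i \<subset> G j" if "i \<in> Npos" "i < j" for i j
      using that(2)
    proof (induction j)
      case (Suc j)
      then have "i = j \<or> i < j" by auto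
      moreover have "G j \<subset> G (Suc j)" using G that(1) \<open>i < Suc j\<close> by (auto simp: Npos_def)
      ultimately show ?case using Suc.IH by blast
    qed simp
    define y where "y i = \<alpha> (G i) + (\<Sum>t\<in>H (G i). f i t)" for i
    \<comment> \<open>The set at which the first \<open>k\<close> blocks end; the empty set stands
      for the start, before any block.\<close>
    define last where "last k = (if k = 0 then {} else G (Max (\<beta> k)))" for k
    have "k \<le> m \<Longrightarrow> (k, \<lambda>j\<in>{1..k}. \<Sum>i\<in>\<beta> j. y i) \<in> S (last k)" for k
    proof (induction k)
      case 0
      then show ?case using S0 by (simp add: last_def restrict_def)
    next
      case (Suc k)
      have B: "\<beta> (Suc k) \<subseteq> Npos" "finite (\<beta> (Suc k))" "\<beta> (Suc k) \<noteq> {}"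
        using \<beta>(1)[of "Suc k"] Suc.prems by (auto simp: Pf_def)
      let ?x = "\<lambda>j\<in>{1..k}. \<Sum>i\<in>\<beta> j. y i"
      have st: "(k, ?x) \<in> S (last k)" using Suc.prems by (intro Suc.IH) simp
      have "(Suc k, ?x(Suc k := \<Sum>i\<in>\<beta> (Suc k). y i)) \<in> S (G (Max (\<beta> (Suc k))))"
      proof (rule block_sum_state[OF B(2,3), where S = S])
        show "G i \<subset> G j" if "i \<in> \<beta> (Suc k)" "j \<in> \<beta> (Suc k)" "i < j" for i j
          using mono B(1) that by blast
        fix i assume i: "i \<in> \<beta> (Suc k)"
        then have Gi: "G i \<in> Pf Npos_fun" "f i \<in> G i" using B(1) G f by auto
        \<comment> \<open>Indices between consecutive blocks can be skipped, because a state may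
          pass to any strictly larger set.\<close>
        have "last k \<subset> G i"
        proof (cases "k = 0")
          case True
          then show ?thesis using Gi by (auto simp: last_def)
        next
          case False
          then have "Max (\<beta> k) < Min (\<beta> (Suc k))" "\<beta> k \<in> Pf Npos"
            using \<beta>(1)[of k] \<beta>(2)[of k] Suc.prems by (auto simp: block_less_def)
          moreover from this have "Max (\<beta> k) \<in> Npos" using Max_in_Npos by blast
          moreover have "Min (\<beta> (Suc k)) \<le> i" using B i by simp
          ultimately show ?thesis using False mono by (simp add: last_def)
        qed
        then show "(Suc k, ?x(Suc k := y i)) \<in> S (G i)"
          unfolding y_def[of i] using Suc.prems by (intro new[OF Gi(1) _ Gi(2) st]) auto
      next
        fix i j x assume "i \<in> \<beta> (Suc k)" "j \<in> \<beta> (Suc k)" "G i \<subset> G j" "(Suc k, x) \<in> S (G i)"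
        then show "(Suc k, x(Suc k := x (Suc k) + y j)) \<in> S (G j)"
          unfolding y_def[of j] using B(1) G f by (intro add[of "G j" "G i"]) auto
      qed
      then show ?case unfolding restrict_Suc_upd[of "\<lambda>j. \<Sum>i\<in>\<beta> j. y i" k]
        by (simp only: last_def nat.distinct if_False)
    qed
    from this[of m] have st: "(m, \<lambda>j\<in>{1..m}. \<Sum>i\<in>\<beta> j. y i) \<in> S (G (Max (\<beta> m)))"
      using assms(4) by (simp add: last_def)
    have "\<beta> m \<in> Pf Npos" using \<beta>(1)[of m] assms(4) by simp
    then have "Max (\<beta> m) \<in> Npos" by (rule Max_in_Npos)
    then have "extendable p m D m (\<lambda>j\<in>{1..m}. \<Sum>i\<in>\<beta> j. y i)" using ext st G by blast
    then show "(\<lambda>j\<in>{1..m}. \<Sum>i\<in>\<beta> j. \<alpha> (G i) + (\<Sum>t\<in>H (G i). f i t)) \<in> D"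
      by (simp add: extendable_def y_def)
  qed (use \<alpha> H(1) in auto)
qed

section \<open>From chains to idempotents\<close>

lemma infinite_Npos_fun: "infinite Npos_fun"
proof -
  have "inj (\<lambda>n. \<lambda>t\<in>Npos. Suc n)"
    by (rule injI) (metis Npos_def lessI mem_Collect_eq nat.inject restrict_apply')
  moreover have "range (\<lambda>n. \<lambda>t\<in>Npos. Suc n) \<subseteq> Npos_fun"
    by (simp add: Npos_fun_def restrict_PiE_iff image_subset_iff) (simp add: Npos_def)
  ultimately show ?thesis using infinite_iff_countable_subset by blast
qed

lemma Pf_Npos_fun_above:
  assumes "finite G" "G \<subseteq> Npos_fun"
  obtains K where "K \<in> Pf Npos_fun" "G \<subset> K"
proof -
  obtain f where "f \<in> Npos_fun" "f \<notin> G"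
    using infinite_Npos_fun assms by (metis finite_subset subsetI)
  then show thesis using that[of "insert f G"] assms by (auto simp: Pf_def)
qed

text \<open>Represents the closed set of ultrafilters containing every \<open>X G\<close>. For
  decreasing \<open>X\<close> the sets \<open>X G\<close> form a base, since finite sets of
  functions are directed by inclusion.\<close>

definition tail_filter :: "((nat \<Rightarrow> nat) set \<Rightarrow> 'a set) \<Rightarrow> 'a filter" where
  "tail_filter X = (INF G\<in>{G. finite G \<and> G \<subseteq> Npos_fun}. principal (X G))"

lemma eventually_tail_filter:
  assumes "antimono X"
  shows "eventually P (tail_filter X) \<longleftrightarrow> (\<exists>G. finite G \<and> G \<subseteq> Npos_fun \<and> (\<forall>x\<in>X G. P x))"
proof -
  have "eventually P (tail_filter X) \<longleftrightarrow>
      (\<exists>G\<in>{G. finite G \<and> G \<subseteq> Npos_fun}. eventually P (principal (X G)))"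
    unfolding tail_filter_def
  proof (rule eventually_INF_base)
    fix G K :: "(nat \<Rightarrow> nat) set"
    assume "G \<in> {G. finite G \<and> G \<subseteq> Npos_fun}" "K \<in> {G. finite G \<and> G \<subseteq> Npos_fun}"
    moreover have "X (G \<union> K) \<subseteq> X G" "X (G \<union> K) \<subseteq> X K"
      using assms by (auto dest: antimonoD)
    ultimately show "\<exists>L\<in>{G. finite G \<and> G \<subseteq> Npos_fun}. principal (X L) \<le> inf (principal (X G)) (principal (X K))"
      by (intro bexI[of _ "G \<union> K"]) auto
  qed auto
  then show ?thesis by (auto simp: eventually_principal)
qed

lemma tail_filter_neq_bot:
  assumes "antimono X" "\<And>G. finite G \<Longrightarrow> G \<subseteq> Npos_fun \<Longrightarrow> X G \<noteq> {}"
  shows "tail_filter X \<noteq> bot"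
  using assms(2) by (auto simp: trivial_limit_def eventually_tail_filter[OF assms(1)])

text \<open>The bound \<open>K\<close> may depend on \<open>x\<close>, matching the nested
  quantifiers in \<oplus>. In the applications it is the last set of the chain behind
  \<open>x\<close>.\<close>

lemma tail_filter_plus_le:
  assumes anti: "antimono X" "antimono Y" "antimono Z"
    and plus: "\<And>G x. finite G \<Longrightarrow> G \<subseteq> Npos_fun \<Longrightarrow> x \<in> X G \<Longrightarrow>
      \<exists>K. finite K \<and> K \<subseteq> Npos_fun \<and> (\<forall>y\<in>Y K. x + y \<in> Z G)"
  shows "tail_filter X \<oplus> tail_filter Y \<le> tail_filter Z"
proof (rule filter_leI)
  fix P assume "eventually P (tail_filter Z)"
  then obtain G where G: "finite G" "G \<subseteq> Npos_fun" "\<forall>x\<in>Z G. P x"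
    by (auto simp: eventually_tail_filter anti)
  have "eventually (\<lambda>y. P (x + y)) (tail_filter Y)" if "x \<in> X G" for x
    using plus[OF G(1,2) that] G(3) unfolding eventually_tail_filter[OF anti(2)] by blast
  then show "eventually P (tail_filter X \<oplus> tail_filter Y)"
    unfolding eventually_filter_plus eventually_tail_filter[OF anti(1)] using G(1,2) by blast
qed

section \<open>Sums along chains with open positions\<close>

locale block_choice =
  fixes \<alpha> :: "(nat \<Rightarrow> nat) set \<Rightarrow> nat" and H :: "(nat \<Rightarrow> nat) set \<Rightarrow> nat set"
  assumes \<alpha>_pos: "F \<in> Pf Npos_fun \<Longrightarrow> 0 < \<alpha> F"
    and H_Pf: "F \<in> Pf Npos_fun \<Longrightarrow> H F \<in> Pf Npos"
    and H_less: "F \<in> Pf Npos_fun \<Longrightarrow> G \<in> Pf Npos_fun \<Longrightarrow> F \<subset> G \<Longrightarrow> s \<in> H F \<Longrightarrow> t \<in> H G \<Longrightarrow> s < t"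
begin

lemma H_props:
  assumes "F \<in> Pf Npos_fun"
  shows "finite (H F)" "H F \<noteq> {}" "H F \<subseteq> Npos"
  using H_Pf[OF assms] by (auto simp: Pf_def)

definition summand :: "(nat \<Rightarrow> nat) set \<Rightarrow> (nat \<Rightarrow> nat) \<Rightarrow> nat" where
  "summand K g = \<alpha> K + (\<Sum>t\<in>H K. g t)"

lemma summand_pos: "K \<in> Pf Npos_fun \<Longrightarrow> 0 < summand K g"
  using \<alpha>_pos by (simp add: summand_def)

text \<open>\<open>chain_sum G a B K\<close>: along some chain strictly above \<open>G\<close> with largest set \<open>K\<close>, functions are
  chosen at some of the sets and left open at the others; whichever function \<open>j\<close> is used at
  the open sets, the sum is \<open>a + (\<Sum>t\<in>B. j t)\<close>.\<close>

inductive chain_sum :: "(nat \<Rightarrow> nat) set \<Rightarrow> nat \<Rightarrow> nat set \<Rightarrow> (nat \<Rightarrow> nat) set \<Rightarrow> bool"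
  for G :: "(nat \<Rightarrow> nat) set" where
  chosen: "K \<in> Pf Npos_fun \<Longrightarrow> G \<subset> K \<Longrightarrow> g \<in> K \<Longrightarrow> chain_sum G (summand K g) {} K"
| open_set: "K \<in> Pf Npos_fun \<Longrightarrow> G \<subset> K \<Longrightarrow> chain_sum G (\<alpha> K) (H K) K"
| step_chosen: "chain_sum G a B K \<Longrightarrow> K' \<in> Pf Npos_fun \<Longrightarrow> K \<subset> K' \<Longrightarrow> g \<in> K' \<Longrightarrow>
    chain_sum G (a + summand K' g) B K'"
| step_open: "chain_sum G a B K \<Longrightarrow> K' \<in> Pf Npos_fun \<Longrightarrow> K \<subset> K' \<Longrightarrow>
    chain_sum G (a + \<alpha> K') (B \<union> H K') K'"

lemma chain_sum_props:
  assumes "chain_sum G a B K"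
  shows "K \<in> Pf Npos_fun" "G \<subset> K" "0 < a" "finite B" "B \<subseteq> Npos"
  using assms by (induction) (auto simp: summand_pos \<alpha>_pos dest: H_props)

lemma chain_sum_less_H:
  assumes "chain_sum G a B K" "K' \<in> Pf Npos_fun" "K \<subset> K'" "s \<in> B" "t \<in> H K'"
  shows "s < t"
  using assms
proof (induction arbitrary: K' t)
  case (open_set K)
  then show ?case using H_less by blast
next
  case (step_open a B K L)
  have "K \<subset> K'" using step_open by blast
  then show ?case using step_open H_less[of L K' s t] by blast
qed auto

lemma chain_sum_disjoint:
  assumes "chain_sum G a B K" "chain_sum K a' B' K'"
  shows "B \<inter> B' = {}"
proof -
  have "s < t" if "s \<in> B" "t \<in> B'" for s t
    using assms(2,1) that
  proof (induction)
    case (open_set L)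
    then show ?case using chain_sum_less_H by blast
  next
    case (step_open a B2 K2 L)
    have "K \<subset> L" using chain_sum_props(2)[OF step_open.hyps(1)] step_open by blast
    then show ?case using step_open by (metis UnE chain_sum_less_H)
  qed auto
  then show ?thesis by blast
qed

text \<open>The second chain starts strictly above \<open>K\<close>, so its sets can be appended to
  the first one by one.\<close>

lemma chain_sum_trans:
  assumes "chain_sum K a' B' K'" "chain_sum G a B K"
  shows "chain_sum G (a + a') (B \<union> B') K'"
  using assms
proof (induction)
  case (chosen L g)
  then show ?case using chain_sum.step_chosen[of G a B K L g] by simp
next
  case (open_set L)
  then show ?case using chain_sum.step_open[of G a B K L] by simp
next
  case (step_chosen a2 B2 K2 L g)
  then show ?case using chain_sum.step_chosen[of G "a + a2" "B \<union> B2" K2 L g] by (simp add: add.assoc)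
next
  case (step_open a2 B2 K2 L)
  then show ?case using chain_sum.step_open[of G "a + a2" "B \<union> B2" K2 L]
    by (simp add: add.assoc Un_assoc)
qed

lemma chain_sum_antimono:
  assumes "chain_sum G a B K" "G' \<subseteq> G"
  shows "chain_sum G' a B K"
  using assms
proof (induction)
  case (chosen K g)
  then have "G' \<subset> K" by blast
  then show ?case using chosen by (intro chain_sum.chosen)
next
  case (open_set K)
  then have "G' \<subset> K" by blast
  then show ?case using open_set by (intro chain_sum.open_set)
qed (auto intro: chain_sum.intros)

text \<open>Every set of the chain contains \<open>G\<close> and hence \<open>j\<close>, so
  \<open>j\<close> may be chosen at all open sets. Their index sets are disjoint, so the sum over
  \<open>B\<close> splits accordingly.\<close>

lemma chain_sum_close:
  assumes "chain_sum G a B K" "j \<in> G"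
  shows "chain_sum G (a + (\<Sum>t\<in>B. j t)) {} K"
  using assms
proof (induction)
  case (chosen L g)
  then show ?case using chain_sum.chosen[of L G g] by simp
next
  case (open_set L)
  then show ?case using chain_sum.chosen[of L G j] by (auto simp: summand_def)
next
  case (step_chosen a B K L g)
  then show ?case using chain_sum.step_chosen[of G "a + (\<Sum>t\<in>B. j t)" "{}" K L g]
    by (simp add: ac_simps)
next
  case (step_open a B K L)
  have "j \<in> L" using chain_sum_props(2)[OF step_open.hyps(1)] step_open by blast
  moreover have "B \<inter> H L = {}"
    using chain_sum_less_H[OF step_open.hyps] by blast
  then have "(\<Sum>t\<in>B \<union> H L. j t) = (\<Sum>t\<in>B. j t) + (\<Sum>t\<in>H L. j t)"
    using chain_sum_props(4)[OF step_open.hyps(1)] H_props(1)[OF step_open.hyps(2)]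
    by (simp add: sum.union_disjoint)
  ultimately show ?case using chain_sum.step_chosen[OF step_open.IH[OF step_open.prems] step_open.hyps(2,3), of j]
    by (simp add: summand_def ac_simps)
qed

section \<open>Filters of chain sums and of vectors of chain sums\<close>

definition sums_above :: "(nat \<Rightarrow> nat) set \<Rightarrow> nat set" where
  "sums_above G = {x. \<exists>K. chain_sum G x {} K}"

text \<open>Chains start above \<open>G \<union> F\<close>, which makes each \<open>j\<close> in
  \<open>F\<close> a legitimate choice at the open sets. The predicate \<Phi> is constantly true for
  the semigroup \<open>E\<close> and demands \<open>B \<noteq> {}\<close> for its ideal
  \<open>I\<close>.\<close>

definition open_sums_above ::
  "(nat \<Rightarrow> nat) set \<Rightarrow> (nat set \<Rightarrow> bool) \<Rightarrow> (nat \<Rightarrow> nat) set \<Rightarrow> ((nat \<Rightarrow> nat) \<Rightarrow> nat) set" where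
  "open_sums_above F \<Phi> G = {(\<lambda>j. a + (\<Sum>t\<in>B. j t)) | a B. \<Phi> B \<and> (\<exists>K. chain_sum (G \<union> F) a B K)}"

lemma antimono_sums_above: "antimono sums_above"
  by (auto simp: antimono_def sums_above_def intro: chain_sum_antimono)

lemma antimono_open_sums_above: "antimono (open_sums_above F \<Phi>)"
proof (rule antimonoI, rule subsetI)
  fix G G' v assume "G \<subseteq> G'" "v \<in> open_sums_above F \<Phi> G'"
  moreover from this obtain a B K where "v = (\<lambda>j. a + (\<Sum>t\<in>B. j t))" "\<Phi> B" "chain_sum (G' \<union> F) a B K"
    unfolding open_sums_above_def by blast
  moreover from this have "chain_sum (G \<union> F) a B K"
    using \<open>G \<subseteq> G'\<close> by (auto elim: chain_sum_antimono)
  ultimately show "v \<in> open_sums_above F \<Phi> G" unfolding open_sums_above_def by blast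
qed

text \<open>Appending chains adds the vectors and unites their disjoint index sets. Both ideal laws
  follow, as a union is nonempty once either part is.\<close>

lemma open_sums_above_plus_le:
  assumes "\<And>B C. \<Phi> B \<Longrightarrow> \<Psi> C \<Longrightarrow> \<Theta> (B \<union> C)"
  shows "tail_filter (open_sums_above F \<Phi>) \<oplus> tail_filter (open_sums_above F \<Psi>)
    \<le> tail_filter (open_sums_above F \<Theta>)"
proof (intro tail_filter_plus_le antimono_open_sums_above)
  fix G v assume "v \<in> open_sums_above F \<Phi> G"
  then obtain a B K where v: "v = (\<lambda>j. a + (\<Sum>t\<in>B. j t))" "\<Phi> B" "chain_sum (G \<union> F) a B K"
    unfolding open_sums_above_def by blast
  have "v + w \<in> open_sums_above F \<Theta> G" if "w \<in> open_sums_above F \<Psi> K" for w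
  proof -
    from that obtain b C L where w: "w = (\<lambda>j. b + (\<Sum>t\<in>C. j t))" "\<Psi> C" "chain_sum (K \<union> F) b C L"
      unfolding open_sums_above_def by blast
    \<comment> \<open>The first chain ends above \<open>F\<close>, so a chain above \<open>K\<close>
      is already above \<open>K \<union> F\<close>.\<close>
    have "K \<union> F = K" using chain_sum_props(2)[OF v(3)] by auto
    with w(3) have KL: "chain_sum K b C L" by simp
    have "(\<Sum>t\<in>B \<union> C. j t) = (\<Sum>t\<in>B. j t) + (\<Sum>t\<in>C. j t)" for j :: "nat \<Rightarrow> nat"
      using chain_sum_disjoint[OF v(3) KL] chain_sum_props(4)[OF v(3)] chain_sum_props(4)[OF KL]
      by (simp add: sum.union_disjoint)
    then have "v + w = (\<lambda>j. (a + b) + (\<Sum>t\<in>B \<union> C. j t))"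
      by (simp add: v(1) w(1) plus_fun_def ac_simps)
    then show ?thesis
      using chain_sum_trans[OF KL v(3)] assms[OF v(2) w(2)] unfolding open_sums_above_def by blast
  qed
  moreover have "finite K" "K \<subseteq> Npos_fun"
    using chain_sum_props(1)[OF v(3)] by (auto simp: Pf_def)
  ultimately show "\<exists>K. finite K \<and> K \<subseteq> Npos_fun \<and> (\<forall>w\<in>open_sums_above F \<Psi> K. v + w \<in> open_sums_above F \<Theta> G)"
    by blast
qed

lemma sums_above_neq_bot: "tail_filter sums_above \<noteq> bot"
proof (rule tail_filter_neq_bot[OF antimono_sums_above])
  fix G :: "(nat \<Rightarrow> nat) set" assume "finite G" "G \<subseteq> Npos_fun"
  then obtain K where K: "K \<in> Pf Npos_fun" "G \<subset> K" by (rule Pf_Npos_fun_above)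
  then obtain g where "g \<in> K" by blast
  then show "sums_above G \<noteq> {}" using chosen[OF K] by (auto simp: sums_above_def)
qed

lemma sums_above_plus_le: "tail_filter sums_above \<oplus> tail_filter sums_above \<le> tail_filter sums_above"
proof (intro tail_filter_plus_le antimono_sums_above)
  fix G x assume "x \<in> sums_above G"
  then obtain K where K: "chain_sum G x {} K" by (auto simp: sums_above_def)
  have "x + y \<in> sums_above G" if "y \<in> sums_above K" for y
    using that chain_sum_trans[OF _ K, of y "{}"] by (auto simp: sums_above_def)
  moreover have "finite K" "K \<subseteq> Npos_fun" using chain_sum_props(1)[OF K] by (auto simp: Pf_def)
  ultimately show "\<exists>K. finite K \<and> K \<subseteq> Npos_fun \<and> (\<forall>y\<in>sums_above K. x + y \<in> sums_above G)"
    by blast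
qed

text \<open>For \<open>A\<close> in \<open>p\<close> and a finite set \<open>F\<close>, the J-set
  witnesses \<open>a\<close> and \<open>B\<close> are the constant part and the open indices of one
  chain sum whose coordinates in \<open>F\<close> all lie in \<open>A\<close>.\<close>

lemma idempotent_of_J_sets_exists:
  obtains p :: "nat filter" where "ultra p" "p \<oplus> p = p" "p \<le> tail_filter sums_above"
    "\<And>A. eventually (\<lambda>x. x \<in> A) p \<Longrightarrow> J_set A"
proof -
  let ?Q = "tail_filter sums_above"
  obtain p where p: "p \<le> ?Q" "ultra p" "p \<oplus> p = p"
    and min: "\<And>x. x \<le> ?Q \<Longrightarrow> ultra x \<Longrightarrow> x \<oplus> x = x \<Longrightarrow> x \<oplus> p = x \<Longrightarrow> p \<oplus> x = x \<Longrightarrow> x = p"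
    using minimal_idempotent_exists[OF sums_above_neq_bot sums_above_plus_le] by blast
  show thesis
  proof (rule that[OF p(2,3,1)])
    fix A assume A: "eventually (\<lambda>x. x \<in> A) p"
    show "J_set A"
      unfolding J_set_def
    proof
      fix F assume F: "F \<in> Pf Npos_fun"
      define E I where "E = tail_filter (open_sums_above F (\<lambda>_. True))"
        and "I = tail_filter (open_sums_above F (\<lambda>B. B \<noteq> {}))"
      note ev = eventually_tail_filter[OF antimono_open_sums_above]
      \<comment> \<open>Chain sums without open sets yield constant vectors.\<close>
      have diag: "filtermap (\<lambda>x _. x) p \<le> E"
      proof (rule filter_leI)
        fix P assume "eventually P E"
        then obtain G where G: "finite G" "G \<subseteq> Npos_fun"
          and P: "\<forall>v\<in>open_sums_above F (\<lambda>_. True) G. P v"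
          unfolding E_def ev by blast
        have "P (\<lambda>_. x)" if "x \<in> sums_above (G \<union> F)" for x
        proof -
          from that obtain K where "chain_sum (G \<union> F) x {} K" by (auto simp: sums_above_def)
          then have "(\<lambda>j. x + (\<Sum>t\<in>{}. j t)) \<in> open_sums_above F (\<lambda>_. True) G"
            unfolding open_sums_above_def by blast
          then show ?thesis using P by simp
        qed
        then have "eventually (\<lambda>x. P (\<lambda>_. x)) ?Q"
          unfolding eventually_tail_filter[OF antimono_sums_above]
          using G F by (intro exI[of _ "G \<union> F"]) (auto simp: Pf_def)
        then show "eventually P (filtermap (\<lambda>x _. x) p)"
          unfolding eventually_filtermap using p(1) filter_leD by blast
      qed
      have IE: "I \<le> E"
      proof (rule filter_leI)
        fix P assume "eventually P E"
        moreover have "open_sums_above F (\<lambda>B. B \<noteq> {}) G \<subseteq> open_sums_above F (\<lambda>_. True) G" for G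
          unfolding open_sums_above_def by blast
        ultimately show "eventually P I" unfolding E_def I_def ev by blast
      qed
      have "I \<noteq> bot"
        unfolding I_def
      proof (rule tail_filter_neq_bot[OF antimono_open_sums_above])
        fix G :: "(nat \<Rightarrow> nat) set" assume "finite G" "G \<subseteq> Npos_fun"
        then have "finite (G \<union> F)" "G \<union> F \<subseteq> Npos_fun" using F by (auto simp: Pf_def)
        then obtain K where K: "K \<in> Pf Npos_fun" "G \<union> F \<subset> K" by (rule Pf_Npos_fun_above)
        then show "open_sums_above F (\<lambda>B. B \<noteq> {}) G \<noteq> {}"
          using open_set[OF K] H_props(2)[OF K(1)] unfolding open_sums_above_def by blast
      qed
      have ideal: "I \<oplus> E \<le> I" "E \<oplus> I \<le> I"
        unfolding I_def E_def by (rule open_sums_above_plus_le; simp)+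
      obtain f where f: "f \<le> I" "f \<noteq> bot"
        "\<And>\<pi>. (\<And>v w. \<pi> (v + w) = \<pi> v + \<pi> w) \<Longrightarrow> (\<And>x. \<pi> (\<lambda>_. x) = x) \<Longrightarrow> filtermap \<pi> E \<le> ?Q \<Longrightarrow>
          filtermap \<pi> f = p"
      proof (rule ideal_filter_over_minimal_idempotent
          [OF p(2,3) min _ diag IE \<open>I \<noteq> bot\<close> ideal])
        show "(\<lambda>_. x + y) = (\<lambda>_. x) + (\<lambda>_. y)" for x y :: nat by (simp add: plus_fun_def)
      qed blast+
      have "eventually (\<lambda>v. v j \<in> A) f" if "j \<in> F" for j
      proof -
        \<comment> \<open>Filling the open sets with \<open>j\<close> turns coordinate
          \<open>j\<close> into an ordinary chain sum.\<close>
        have "filtermap (\<lambda>v. v j) E \<le> ?Q"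
        proof (rule filter_leI)
          fix P assume "eventually P ?Q"
          then obtain G where G: "finite G" "G \<subseteq> Npos_fun" and P: "\<forall>x\<in>sums_above G. P x"
            unfolding eventually_tail_filter[OF antimono_sums_above] by blast
          have "P (v j)" if "v \<in> open_sums_above F (\<lambda>_. True) G" for v
          proof -
            from that obtain a B K where v: "v = (\<lambda>j. a + (\<Sum>t\<in>B. j t))" "chain_sum (G \<union> F) a B K"
              unfolding open_sums_above_def by blast
            have "chain_sum G (v j) {} K"
              using chain_sum_antimono[OF chain_sum_close[OF v(2)], of j G] \<open>j \<in> F\<close> v(1) by simp
            then show ?thesis using P by (auto simp: sums_above_def)
          qed
          then show "eventually P (filtermap (\<lambda>v. v j) E)"
            unfolding eventually_filtermap E_def ev using G by blast
        qed
        then have "filtermap (\<lambda>v. v j) f = p" by (intro f(3)) auto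
        then show ?thesis using A by (auto simp: eventually_filtermap)
      qed
      then have "eventually (\<lambda>v. \<forall>j\<in>F. v j \<in> A) f"
        using F by (intro eventually_ball_finite) (auto simp: Pf_def)
      moreover have "eventually (\<lambda>v. v \<in> open_sums_above F (\<lambda>B. B \<noteq> {}) {}) I"
        unfolding I_def ev by blast
      then have "eventually (\<lambda>v. v \<in> open_sums_above F (\<lambda>B. B \<noteq> {}) {}) f"
        using f(1) filter_leD by blast
      \<comment> \<open>\<open>f\<close> is proper, so one vector meets all these conditions; coming
        from the ideal, it has a nonempty \<open>B\<close>.\<close>
      ultimately obtain v where v: "\<forall>j\<in>F. v j \<in> A" "v \<in> open_sums_above F (\<lambda>B. B \<noteq> {}) {}"
        using eventually_happens'[OF f(2) eventually_conj] by blast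
      then obtain a B K where aB: "v = (\<lambda>j. a + (\<Sum>t\<in>B. j t))" "B \<noteq> {}" "chain_sum ({} \<union> F) a B K"
        unfolding open_sums_above_def by blast
      then show "\<exists>a\<in>Npos. \<exists>B\<in>Pf Npos. \<forall>f\<in>F. a + (\<Sum>t\<in>B. f t) \<in> A"
        using v(1) chain_sum_props[OF aB(3)] aB(1,2)
        by (intro bexI[of _ a] bexI[of _ B]) (auto simp: Pf_def Npos_def)
    qed
  qed
qed

section \<open>Finite chains and tuples of block sums\<close>

definition chain_upto :: "nat \<Rightarrow> (nat \<Rightarrow> (nat \<Rightarrow> nat) set) \<Rightarrow> (nat \<Rightarrow> nat \<Rightarrow> nat) \<Rightarrow> bool" where
  "chain_upto n G f \<longleftrightarrow> G 0 = {} \<and> (\<forall>i\<in>{1..n}. G i \<in> Pf Npos_fun \<and> f i \<in> G i) \<and>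
     (\<forall>i<n. G i \<subset> G (Suc i))"

lemma chain_upto_snoc:
  assumes "chain_upto n G f" "K \<in> Pf Npos_fun" "G n \<subset> K" "g \<in> K"
  shows "chain_upto (Suc n) (G(Suc n := K)) (f(Suc n := g))"
  unfolding chain_upto_def
proof (intro conjI ballI allI impI)
  fix i assume "i \<in> {1..Suc n}"
  then show "(G(Suc n := K)) i \<in> Pf Npos_fun" "(f(Suc n := g)) i \<in> (G(Suc n := K)) i"
    using assms by (cases "i = Suc n"; simp add: chain_upto_def)+
next
  fix i assume "i < Suc n"
  then show "(G(Suc n := K)) i \<subset> (G(Suc n := K)) (Suc i)"
    using assms by (cases "i = n"; simp add: chain_upto_def)
qed (use assms in \<open>simp add: chain_upto_def\<close>)

text \<open>The sets of the chain behind \<open>x\<close> are numbered from \<open>n + 1\<close> to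
  \<open>n'\<close>, so that \<open>x\<close> becomes the sum over one interval of indices.\<close>

lemma chain_upto_extend:
  assumes "chain_sum (G n) x {} K" "chain_upto n G f"
  shows "\<exists>n' G' f'. n < n' \<and> chain_upto n' G' f' \<and> G' n' = K \<and>
    (\<forall>i\<le>n. G' i = G i \<and> f' i = f i) \<and> x = (\<Sum>i\<in>{n<..n'}. summand (G' i) (f' i))"
proof -
  \<comment> \<open>The induction needs a variable index set. An open set would make it nonempty, as
    \<open>H\<close> takes nonempty values.\<close>
  have "?thesis" if "chain_sum (G n) x B K" "B = {}" for B
    using that
  proof (induction)
    case (chosen K g)
    define G' f' where "G' = G(Suc n := K)" and "f' = f(Suc n := g)"
    have "chain_upto (Suc n) G' f'"
      unfolding G'_def f'_def using assms(2) chosen.hyps by (rule chain_upto_snoc)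
    moreover have "{n<..Suc n} = {Suc n}" by auto
    moreover have "G' (Suc n) = K" "f' (Suc n) = g" "\<forall>i\<le>n. G' i = G i \<and> f' i = f i"
      by (auto simp: G'_def f'_def)
    ultimately show ?case
      by (intro exI[of _ "Suc n"] exI[of _ G'] exI[of _ f']) simp
  next
    case (open_set K)
    then show ?case using H_props(2)[OF open_set.hyps(1)] by blast
  next
    case (step_chosen a B K L g)
    then obtain n' G' f' where n': "n < n'" "chain_upto n' G' f'" "G' n' = K"
      "\<forall>i\<le>n. G' i = G i \<and> f' i = f i" "a = (\<Sum>i\<in>{n<..n'}. summand (G' i) (f' i))"
      by blast
    define G'' f'' where "G'' = G'(Suc n' := L)" and "f'' = f'(Suc n' := g)"
    have "chain_upto (Suc n') G'' f''"
      unfolding G''_def f''_def using step_chosen.hyps n'(3)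
      by (intro chain_upto_snoc[OF n'(2)]) simp_all
    moreover have G'': "G'' (Suc n') = L" "f'' (Suc n') = g" "\<forall>i\<le>n'. G'' i = G' i \<and> f'' i = f' i"
      by (auto simp: G''_def f''_def)
    moreover have "{n<..Suc n'} = insert (Suc n') {n<..n'}" using n'(1) by auto
    then have "a + summand L g = (\<Sum>i\<in>{n<..Suc n'}. summand (G'' i) (f'' i))"
      by (simp add: n'(5) G'')
    ultimately show ?case
      using n'(1,4) by (intro exI[of _ "Suc n'"] exI[of _ G''] exI[of _ f'']) simp
  next
    case (step_open a B K L)
    then show ?case using H_props(2)[OF step_open.hyps(2)] by blast
  qed
  with assms(1) show ?thesis by blast
qed

text \<open>Condition (b) speaks of infinite sequences, while a block tuple comes from a finite
  chain; repeated proper enlargement continues the chain.\<close>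

lemma chain_upto_infinite:
  assumes "chain_upto n G f"
  obtains G' f' where "\<And>i. i \<le> n \<Longrightarrow> G' i = G i \<and> f' i = f i"
    "\<And>i. i \<in> Npos \<Longrightarrow> G' i \<in> Pf Npos_fun \<and> f' i \<in> G' i" "\<And>i. G' i \<subset> G' (Suc i)"
proof -
  let ?fin = "\<lambda>K. finite K \<and> K \<subseteq> Npos_fun"
  define up where "up K = (SOME K'. K' \<in> Pf Npos_fun \<and> K \<subset> K')" for K
  have up: "up K \<in> Pf Npos_fun \<and> K \<subset> up K" if "?fin K" for K
  proof -
    from that have "finite K" "K \<subseteq> Npos_fun" by auto
    then obtain K' where "K' \<in> Pf Npos_fun" "K \<subset> K'" by (rule Pf_Npos_fun_above)
    then show ?thesis unfolding up_def by (rule someI[of _ K', OF conjI])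
  qed
  define G' where "G' i = (if i \<le> n then G i else (up ^^ (i - n)) (G n))" for i
  have Gfin: "?fin (G i)" if "i \<le> n" for i
  proof (cases "i = 0")
    case False
    then have "G i \<in> Pf Npos_fun" using assms that by (simp add: chain_upto_def)
    then show ?thesis by (simp add: Pf_def)
  qed (use assms in \<open>simp add: chain_upto_def\<close>)
  have "?fin ((up ^^ k) (G n))" for k
  proof (induction k)
    case 0
    then show ?case using Gfin[of n] by simp
  next
    case (Suc k)
    then show ?case using up[of "(up ^^ k) (G n)"] unfolding Pf_def by simp
  qed
  then have fin: "?fin (G' i)" for i using Gfin by (simp add: G'_def)
  have Suc: "G' (Suc i) = up (G' i)" if "n \<le> i" for i
    using that by (auto simp: G'_def Suc_diff_le)
  have mono: "G' i \<subset> G' (Suc i)" for i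
  proof (cases "n \<le> i")
    case True
    then show ?thesis using Suc up[OF fin] by simp
  next
    case False
    then show ?thesis using assms by (simp add: G'_def chain_upto_def)
  qed
  have ne: "G' i \<noteq> {}" if "i \<in> Npos" for i
  proof -
    have "G' (i - 1) \<subset> G' i" using mono[of "i - 1"] that by (simp add: Npos_def)
    then show ?thesis by blast
  qed
  define f' where "f' i = (if i \<le> n then f i else (SOME g. g \<in> G' i))" for i
  show thesis
  proof (rule that[of G' f'])
    show "G' i = G i \<and> f' i = f i" if "i \<le> n" for i using that by (simp add: G'_def f'_def)
    fix i assume i: "i \<in> Npos"
    have "f' i \<in> G' i"
    proof (cases "i \<le> n")
      case True
      then show ?thesis using assms i by (auto simp: G'_def f'_def chain_upto_def Npos_def)
    next
      case False
      then show ?thesis using ne[OF i] by (simp add: f'_def some_in_eq)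
    qed
    then show "G' i \<in> Pf Npos_fun \<and> f' i \<in> G' i" using fin ne[OF i] by (simp add: Pf_def)
  qed (rule mono)
qed

text \<open>The last set \<open>K\<close> of the chain is a parameter because the next block has to
  start above it.\<close>

definition block_tuple :: "nat \<Rightarrow> (nat \<Rightarrow> nat) \<Rightarrow> (nat \<Rightarrow> nat) set \<Rightarrow> bool" where
  "block_tuple k x K \<longleftrightarrow> (\<exists>n G f \<beta>. chain_upto n G f \<and> G n = K \<and>
     (\<forall>j\<in>{1..k}. \<beta> j \<in> Pf Npos \<and> \<beta> j \<subseteq> {1..n}) \<and>
     (\<forall>j\<in>{1..<k}. block_less (\<beta> j) (\<beta> (Suc j))) \<and>
     x = (\<lambda>j\<in>{1..k}. \<Sum>i\<in>\<beta> j. summand (G i) (f i)))"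

lemma block_tuple_0: "block_tuple 0 (\<lambda>_. undefined) {}"
  unfolding block_tuple_def
  by (intro exI[of _ 0] exI[of _ "\<lambda>_. {}"] exI[of _ "\<lambda>_. undefined"] exI[of _ "\<lambda>_. {}"])
    (auto simp: chain_upto_def restrict_def)

text \<open>The new block is an interval of indices beyond \<open>n\<close>, whereas the earlier
  blocks lie in \<open>{1..n}\<close>.\<close>

lemma block_tuple_Suc:
  assumes "block_tuple k x K" "chain_sum K y {} L"
  shows "block_tuple (Suc k) (x(Suc k := y)) L"
proof -
  obtain n G f \<beta> where G: "chain_upto n G f" "G n = K"
    and \<beta>: "\<And>j. j \<in> {1..k} \<Longrightarrow> \<beta> j \<in> Pf Npos \<and> \<beta> j \<subseteq> {1..n}"
      "\<And>j. j \<in> {1..<k} \<Longrightarrow> block_less (\<beta> j) (\<beta> (Suc j))"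
    and x: "x = (\<lambda>j\<in>{1..k}. \<Sum>i\<in>\<beta> j. summand (G i) (f i))"
    using assms(1) unfolding block_tuple_def by blast
  obtain n' G' f' where n': "n < n'" and G': "chain_upto n' G' f'" "G' n' = L"
    "\<forall>i\<le>n. G' i = G i \<and> f' i = f i" and y: "y = (\<Sum>i\<in>{n<..n'}. summand (G' i) (f' i))"
    using chain_upto_extend[OF _ G(1), of y L] assms(2) G(2) by blast
  define \<beta>' where "\<beta>' = \<beta>(Suc k := {n<..n'})"
  have "\<beta>' j \<in> Pf Npos \<and> \<beta>' j \<subseteq> {1..n'}" if "j \<in> {1..Suc k}" for j
  proof (cases "j = Suc k")
    case True
    then show ?thesis using n' by (auto simp: \<beta>'_def Pf_def Npos_def)
  next
    case False
    then have "\<beta> j \<in> Pf Npos" "\<beta> j \<subseteq> {1..n}" using \<beta>(1)[of j] that by auto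
    then show ?thesis using False n' by (auto simp: \<beta>'_def)
  qed
  moreover have "block_less (\<beta>' j) (\<beta>' (Suc j))" if "j \<in> {1..<Suc k}" for j
  proof (cases "j = k")
    case True
    then have b: "\<beta> k \<in> Pf Npos" "\<beta> k \<subseteq> {1..n}" using \<beta>(1)[of k] that by auto
    then have "Max (\<beta> k) \<in> \<beta> k" by (intro Max_in) (auto simp: Pf_def)
    then have "Max (\<beta> k) \<le> n" using b(2) by auto
    moreover have "n < Min {n<..n'}" using n' by (subst Min_gr_iff) auto
    ultimately show ?thesis using True by (simp add: \<beta>'_def block_less_def)
  next
    case False
    then show ?thesis using \<beta>(2)[of j] that by (simp add: \<beta>'_def)
  qed
  moreover have "x(Suc k := y) = (\<lambda>j\<in>{1..Suc k}. \<Sum>i\<in>\<beta>' j. summand (G' i) (f' i))"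
  proof -
    have "(\<Sum>i\<in>\<beta> j. summand (G i) (f i)) = (\<Sum>i\<in>\<beta>' j. summand (G' i) (f' i))" if "j \<in> {1..k}" for j
      using \<beta>(1)[OF that] that G'(3) by (intro sum.cong) (auto simp: \<beta>'_def)
    then have "x = (\<lambda>j\<in>{1..k}. \<Sum>i\<in>\<beta>' j. summand (G' i) (f' i))"
      unfolding x by (intro restrict_ext) auto
    then show ?thesis
      using y restrict_Suc_upd[of "\<lambda>j. \<Sum>i\<in>\<beta>' j. summand (G' i) (f' i)" k] by (simp add: \<beta>'_def)
  qed
  ultimately show ?thesis
    unfolding block_tuple_def using G'(1,2) by blast
qed

lemma block_tuple_in_tuples:
  assumes "block_tuple k x K"
  shows "x \<in> tuples k"
proof -
  obtain n G f \<beta> where G: "chain_upto n G f"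
    and \<beta>: "\<And>j. j \<in> {1..k} \<Longrightarrow> \<beta> j \<in> Pf Npos \<and> \<beta> j \<subseteq> {1..n}"
    and x: "x = (\<lambda>j\<in>{1..k}. \<Sum>i\<in>\<beta> j. summand (G i) (f i))"
    using assms unfolding block_tuple_def by blast
  have "0 < (\<Sum>i\<in>\<beta> j. summand (G i) (f i))" if "j \<in> {1..k}" for j
  proof (rule sum_pos)
    show "finite (\<beta> j)" "\<beta> j \<noteq> {}" using \<beta>[OF that] by (auto simp: Pf_def)
    show "0 < summand (G i) (f i)" if "i \<in> \<beta> j" for i
      using \<beta>[OF \<open>j \<in> _\<close>] that G by (intro summand_pos) (auto simp: chain_upto_def)
  qed
  then show ?thesis by (auto simp: x tuples_def Npos_def)
qed

lemma block_tuple_subset_Npos_fun: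
  assumes "block_tuple k x K"
  shows "finite K" "K \<subseteq> Npos_fun"
proof -
  obtain n G f where "chain_upto n G f" "G n = K"
    using assms unfolding block_tuple_def by blast
  then show "finite K" "K \<subseteq> Npos_fun" by (cases "n = 0"; force simp: chain_upto_def Pf_def)+
qed

end

section \<open>From filters back to ultrafilters on a set\<close>

definition trace_on :: "'a set \<Rightarrow> 'a filter \<Rightarrow> 'a set set" where
  "trace_on X p = {A. A \<subseteq> X \<and> eventually (\<lambda>x. x \<in> A) p}"

lemma Collect_mem_trace_on:
  assumes "eventually (\<lambda>x. x \<in> X) p"
  shows "{x \<in> X. P x} \<in> trace_on X p \<longleftrightarrow> eventually P p"
  using assms by (auto simp: trace_on_def eventually_conj_iff)

lemma ultrafilter_on_trace_on:
  assumes "ultra p" "eventually (\<lambda>x. x \<in> X) p"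
  shows "ultrafilter_on X (trace_on X p)"
  unfolding ultrafilter_on_def
proof (intro conjI ballI allI impI)
  show "{} \<notin> trace_on X p"
    using ultra_neq_bot[OF assms(1)] by (simp add: trace_on_def trivial_limit_def)
  show "A \<in> trace_on X p \<or> X - A \<in> trace_on X p" if "A \<subseteq> X" for A
    using assms that ultra_not_eventually[OF assms(1), of "\<lambda>x. x \<in> A"]
    by (auto simp: trace_on_def eventually_conj_iff)
  show "B \<in> trace_on X p" if "A \<in> trace_on X p" "A \<subseteq> B \<and> B \<subseteq> X" for A B
    using that by (auto simp: trace_on_def elim: eventually_mono)
qed (use assms in \<open>auto simp: trace_on_def eventually_conj_iff\<close>)

lemma uf_plus_trace_on:
  assumes "eventually (\<lambda>x. x \<in> Npos) p" "p \<oplus> p = p"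
  shows "uf_plus (trace_on Npos p) (trace_on Npos p) = trace_on Npos p"
proof -
  have "eventually (\<lambda>x. x \<in> A) p \<longleftrightarrow> (\<forall>\<^sub>F x in p. \<forall>\<^sub>F y in p. x + y \<in> A)" for A
    using eventually_filter_plus[of "\<lambda>x. x \<in> A" p p] assms(2) by simp
  then show ?thesis
    by (simp add: uf_plus_def Collect_mem_trace_on[OF assms(1)]) (simp add: trace_on_def)
qed

text \<open>If \<open>K\<close> is the last set behind the tuple built so far, then
  \<open>p\<close>-most \<open>y\<close> are chain sums above \<open>K\<close>, and each of these
  can serve as the next block. Induction on the number of remaining coordinates ends with tuples
  covered by \<open>conf\<close>.\<close>

theorem (in block_choice) idempotent_if_configuration:
  assumes conf: "\<And>x K. block_tuple m x K \<Longrightarrow> x \<in> D"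
  shows "\<exists>p. p \<in> J_ultrafilters \<and> uf_idempotent p \<and> tensor_section p m 0 D (\<lambda>_. undefined)"
proof -
  obtain p :: "nat filter" where p: "ultra p" "p \<oplus> p = p" "p \<le> tail_filter sums_above"
    and J: "\<And>A. eventually (\<lambda>x. x \<in> A) p \<Longrightarrow> J_set A"
    by (rule idempotent_of_J_sets_exists) blast
  have above: "eventually (\<lambda>x. x \<in> sums_above K) p" if "finite K" "K \<subseteq> Npos_fun" for K
  proof (rule filter_leD[OF p(3)])
    show "eventually (\<lambda>x. x \<in> sums_above K) (tail_filter sums_above)"
      unfolding eventually_tail_filter[OF antimono_sums_above] using that by blast
  qed
  \<comment> \<open>Chain sums are positive, so \<open>p\<close> concentrates on the positive
    integers and can be restricted to them.\<close>
  have "sums_above {} \<subseteq> Npos"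
    using chain_sum_props(3) by (auto simp: sums_above_def Npos_def)
  then have Npos: "eventually (\<lambda>x. x \<in> Npos) p"
    using above[of "{}"] by (auto elim: eventually_mono)
  let ?p = "trace_on Npos p"
  have "?p \<in> J_ultrafilters"
    using ultrafilter_on_trace_on[OF p(1) Npos] J
    by (auto simp: J_ultrafilters_def stone_cech_def trace_on_def)
  moreover have "uf_idempotent ?p"
    unfolding uf_idempotent_def by (rule uf_plus_trace_on[OF Npos p(2)])
  moreover have "tensor_section ?p r k D x" if "block_tuple k x K" "k + r = m" for r k x K
    using that
  proof (induction r arbitrary: k x K)
    case 0
    then show ?case using conf by simp
  next
    case (Suc r)
    have "eventually (\<lambda>y. tensor_section ?p r (Suc k) D (x(Suc k := y))) p"
      using above[OF block_tuple_subset_Npos_fun[OF Suc.prems(1)]]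
    proof eventually_elim
      case (elim y)
      then obtain L where "chain_sum K y {} L" by (auto simp: sums_above_def)
      then show ?case
        using Suc.prems(2) by (intro Suc.IH[OF block_tuple_Suc[OF Suc.prems(1)]]) auto
    qed
    then show ?case by (simp add: Collect_mem_trace_on[OF Npos])
  qed
  from this[OF block_tuple_0, of m] have "tensor_section ?p m 0 D (\<lambda>_. undefined)" by simp
  ultimately show ?thesis by blast
qed

section \<open>Reduction to the set \<open>D\<close> and the equivalence of (1) and (2)\<close>

theorem corollary1p32:
  fixes m :: nat and h :: "(nat \<Rightarrow> nat) \<Rightarrow> nat" and A :: "nat set"
  assumes "m \<in> Npos"
    and "poly_map_no_const m h"
    and "A \<subseteq> Npos"
  shows
    "(\<exists>\<alpha> H. \<alpha> \<in> Pf Npos_fun \<rightarrow> Npos \<and> H \<in> Pf Npos_fun \<rightarrow> Pf Npos \<and>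
        (\<forall>F\<in>Pf Npos_fun. \<forall>G\<in>Pf Npos_fun. F \<subset> G \<longrightarrow> Max (H F) < Min (H G)) \<and>
        (\<forall>G :: nat \<Rightarrow> (nat \<Rightarrow> nat) set.
           (\<forall>i\<in>Npos. G i \<in> Pf Npos_fun) \<and> (\<forall>i\<in>Npos. G i \<subset> G (Suc i)) \<longrightarrow>
           (\<forall>\<beta> :: nat \<Rightarrow> nat set. \<forall>f :: nat \<Rightarrow> nat \<Rightarrow> nat.
              (\<forall>j\<in>{1..m}. \<beta> j \<in> Pf Npos) \<and> (\<forall>j\<in>{1..<m}. block_less (\<beta> j) (\<beta> (Suc j))) \<and>
              (\<forall>i\<in>Npos. f i \<in> G i) \<longrightarrow>
              h (\<lambda>j\<in>{1..m}. \<Sum>i\<in>\<beta> j. \<alpha> (G i) + (\<Sum>t\<in>H (G i). f i t)) \<in> A)))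
     \<longleftrightarrow>
     (\<exists>p. p \<in> J_ultrafilters \<and> uf_idempotent p \<and>
          A \<in> uf_extension (tuples m) h (uf_tensor (\<lambda>i. p) m))"
    (is "?L \<longleftrightarrow> ?R")
proof -
  define D where "D = {x \<in> tuples m. h x \<in> A}"
  have "A \<in> uf_extension (tuples m) h (uf_tensor (\<lambda>i. p) m) \<longleftrightarrow>
      tensor_section p m 0 D (\<lambda>_. undefined)" for p
    using mem_uf_tensor_iff[of D m p] assms(3) by (auto simp: uf_extension_def D_def)
  then have R: "?R \<longleftrightarrow>
      (\<exists>p. p \<in> J_ultrafilters \<and> uf_idempotent p \<and> tensor_section p m 0 D (\<lambda>_. undefined))"
    by simp
  show ?thesis
  proof
    assume ?L
    then obtain \<alpha> H where \<alpha>: "\<alpha> \<in> Pf Npos_fun \<rightarrow> Npos" and H: "H \<in> Pf Npos_fun \<rightarrow> Pf Npos"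
      and less: "\<forall>F\<in>Pf Npos_fun. \<forall>G\<in>Pf Npos_fun. F \<subset> G \<longrightarrow> Max (H F) < Min (H G)"
      and conf: "\<forall>G :: nat \<Rightarrow> (nat \<Rightarrow> nat) set.
        (\<forall>i\<in>Npos. G i \<in> Pf Npos_fun) \<and> (\<forall>i\<in>Npos. G i \<subset> G (Suc i)) \<longrightarrow>
        (\<forall>\<beta> :: nat \<Rightarrow> nat set. \<forall>f :: nat \<Rightarrow> nat \<Rightarrow> nat.
           (\<forall>j\<in>{1..m}. \<beta> j \<in> Pf Npos) \<and> (\<forall>j\<in>{1..<m}. block_less (\<beta> j) (\<beta> (Suc j))) \<and>
           (\<forall>i\<in>Npos. f i \<in> G i) \<longrightarrow>
           h (\<lambda>j\<in>{1..m}. \<Sum>i\<in>\<beta> j. \<alpha> (G i) + (\<Sum>t\<in>H (G i). f i t)) \<in> A)"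
      by (elim exE conjE)
    interpret block_choice \<alpha> H
    proof
      show "0 < \<alpha> F" if "F \<in> Pf Npos_fun" for F using \<alpha> that by (auto simp: Npos_def)
      show HPf: "H F \<in> Pf Npos" if "F \<in> Pf Npos_fun" for F using H that by auto
      show "s < t" if "F \<in> Pf Npos_fun" "G \<in> Pf Npos_fun" "F \<subset> G" "s \<in> H F" "t \<in> H G" for F G s t
      proof -
        have "s \<le> Max (H F)" "Min (H G) \<le> t"
          using HPf that by (auto simp: Pf_def)
        then show ?thesis using less that(1-3) by fastforce
      qed
    qed
    have "x \<in> D" if x: "block_tuple m x K" for x K
    proof -
      obtain n G f \<beta> where G: "chain_upto n G f"
        and \<beta>: "\<forall>j\<in>{1..m}. \<beta> j \<in> Pf Npos \<and> \<beta> j \<subseteq> {1..n}"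
          "\<forall>j\<in>{1..<m}. block_less (\<beta> j) (\<beta> (Suc j))"
        and x_eq: "x = (\<lambda>j\<in>{1..m}. \<Sum>i\<in>\<beta> j. summand (G i) (f i))"
        using x unfolding block_tuple_def by blast
      obtain G' f' where G': "\<And>i. i \<le> n \<Longrightarrow> G' i = G i \<and> f' i = f i"
        "\<And>i. i \<in> Npos \<Longrightarrow> G' i \<in> Pf Npos_fun \<and> f' i \<in> G' i" "\<And>i. G' i \<subset> G' (Suc i)"
        using chain_upto_infinite[OF G] by blast
      have "h (\<lambda>j\<in>{1..m}. \<Sum>i\<in>\<beta> j. \<alpha> (G' i) + (\<Sum>t\<in>H (G' i). f' i t)) \<in> A"
      proof (rule conf[THEN spec, THEN mp, THEN spec, THEN spec, THEN mp])
        show "(\<forall>i\<in>Npos. G' i \<in> Pf Npos_fun) \<and> (\<forall>i\<in>Npos. G' i \<subset> G' (Suc i))"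
          using G'(2,3) by blast
        show "(\<forall>j\<in>{1..m}. \<beta> j \<in> Pf Npos) \<and> (\<forall>j\<in>{1..<m}. block_less (\<beta> j) (\<beta> (Suc j))) \<and>
            (\<forall>i\<in>Npos. f' i \<in> G' i)"
          using \<beta> G'(2) by blast
      qed
      moreover have "x = (\<lambda>j\<in>{1..m}. \<Sum>i\<in>\<beta> j. \<alpha> (G' i) + (\<Sum>t\<in>H (G' i). f' i t))"
        unfolding x_eq
      proof (intro restrict_ext sum.cong refl)
        fix j i assume "j \<in> {1..m}" "i \<in> \<beta> j"
        then have "i \<le> n" using \<beta>(1) by force
        then show "summand (G i) (f i) = \<alpha> (G' i) + (\<Sum>t\<in>H (G' i). f' i t)"
          using G'(1)[of i] by (simp add: summand_def)
      qed
      ultimately show ?thesis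
        using block_tuple_in_tuples[OF x] by (simp add: D_def)
    qed
    then show ?R unfolding R by (rule idempotent_if_configuration)
  next
    assume ?R
    then obtain p where p: "p \<in> J_ultrafilters" "uf_idempotent p"
      "tensor_section p m 0 D (\<lambda>_. undefined)"
      unfolding R by blast
    have "0 < m" using assms(1) by (simp add: Npos_def)
    \<comment> \<open>Under the same quantifiers, membership of the tuple in \<open>D\<close> is
      weakened to its second part, the condition on \<open>h\<close>.\<close>
    from configuration_if_idempotent[OF p this] show ?L
      unfolding D_def mem_Collect_eq
      by (elim ex_forward conj_forward all_forward imp_forward) (assumption | erule conjunct2)+
  qed
qed

end
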